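(* Under the standing assumptions of the context, as $l\to\infty$, $$|\Delta^2_{\varphi_l^{\bot}}-\Delta^2_{\varphi^M}|=O\Big(\max\big\{\mu(l),\,l\,C_0^{-l+2\log_2\frac{1+\varepsilon(l)}{c}}\big\}\Big),\qquad C_0:=\frac{32\pi^2e^{2\omega_0}}{27}.$$
   Context: Fourier transform: $\widehat f(\omega)=\int_{\mathbb{R}}f(t)e^{-it\omega}\,dt$. Let $\theta$ be odd, non-decreasing, $C^2$, with $\theta(\omega)=\pi/4$ for $\omega>\pi/3$; fix $\pi/3\le\omega_0<\pi/2$. Meyer scaling function: $\widehat{\varphi^M}(\omega)=1$ for $|\omega|\le2\omega_0$, $=\cos(\frac\pi4+\theta(\frac{\pi}{3(\pi-2\omega_0)}(|\omega|-\pi)))$ for $2\omega_0<|\omega|\le2\pi-2\omega_0$, $=0$ otherwise. Meyer mask: $2\pi$-periodic $m^M$ with $m^M(\omega)=\widehat{\varphi^M}(2\omega)$ on $[-\pi,\pi]$. $\|\cdot\|_C$: sup norm on $[-\pi,\pi]$. A linear method of summation $(\lambda_{n,k})$ maps $f$ with Fourier coefficients $a_k,b_k$ to $u_n(f,\omega)=\frac{a_0}2+\sum_{k=1}^n\lambda_{n,k}(a_k\cos k\omega+b_k\sin k\omega)$. $m^M_l:=m^M/(\cos\frac\omega2)^{2l}$. Standing assumptions: a method and a sequence $n(l)$ are fixed with $u_l:=u_{n(l)}(m^M_l,\cdot)$, $u_{1,l}:=u_{n(l)}((m^M_l)',\cdot)$ satisfying $\alpha(l):=\|u_l-m^M_l\|_C=o(l^{-1})$,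 $\gamma(l):=\|u_{1,l}-(m^M_l)'\|_C=o(1)$, $u_l(\pi)\ne0$; $l_0$ is fixed with $c:=\inf_{l\ge l_0}|u_l(0)|>0$ and $l\ge l_0$. $\varepsilon(l):=\alpha(l)/\|m^M_l\|_C$, $\mu(l):=l\alpha(l)+\gamma(l)$. $m_l(\omega):=(\cos\frac\omega2)^{2l}u_l(\omega)/u_l(0)$, $\widehat{\varphi_l}(\omega):=\prod_{j\ge1}m_l(\omega2^{-j})$, $\Phi_l(\omega):=\sum_{k}|\widehat{\varphi_l}(\omega+2\pi k)|^2$, $\widehat{\varphi_l^{\bot}}:=\widehat{\varphi_l}\Phi_l^{-1/2}$. Time radius: $\Delta_f^2=\|f\|_{L^2}^{-2}\int(t-t_{0f})^2|f(t)|^2dt$ with $t_{0f}=\|f\|_{L^2}^{-2}\int t|f(t)|^2dt$. *)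

theory Defs
  imports "HOL-Analysis.Analysis" "HOL-Library.Landau_Symbols"
begin

text \<open>Inverse Fourier transform for the convention
  hat f (w) = integral of f(t) e^(-i t w) dt, i.e.
  f(t) = (1/(2 pi)) integral of hat f (w) e^(i t w) dw.\<close>
definition inv_fourier :: "(real \<Rightarrow> complex) \<Rightarrow> real \<Rightarrow> complex" where
  "inv_fourier g t = (1 / (2 * pi)) *\<^sub>R
     (LINT w|lborel. g w * exp (\<i> * complex_of_real (t * w)))"

definition L2norm_sq :: "(real \<Rightarrow> complex) \<Rightarrow> real" where
  "L2norm_sq f = (LINT t|lborel. (cmod (f t))\<^sup>2)"

definition time_centre :: "(real \<Rightarrow> complex) \<Rightarrow> real" where
  "time_centre f = (LINT t|lborel. t * (cmod (f t))\<^sup>2) / L2norm_sq f"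

definition time_radius_sq :: "(real \<Rightarrow> complex) \<Rightarrow> real" where
  "time_radius_sq f =
     (LINT t|lborel. (t - time_centre f)\<^sup>2 * (cmod (f t))\<^sup>2) / L2norm_sq f"

definition C2_real :: "(real \<Rightarrow> real) \<Rightarrow> bool" where
  "C2_real f \<longleftrightarrow> (\<exists>f' f''. (\<forall>x. (f has_real_derivative f' x) (at x)) \<and>
      (\<forall>x. (f' has_real_derivative f'' x) (at x)) \<and> continuous_on UNIV f'')"

definition meyer_hat :: "(real \<Rightarrow> real) \<Rightarrow> real \<Rightarrow> real \<Rightarrow> real" where
  "meyer_hat \<theta> \<omega>0 \<omega> =
     (if \<bar>\<omega>\<bar> \<le> 2 * \<omega>0 then 1
      else if \<bar>\<omega>\<bar> \<le> 2 * pi - 2 * \<omega>0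
        then cos (pi / 4 + \<theta> (pi / (3 * (pi - 2 * \<omega>0)) * (\<bar>\<omega>\<bar> - pi)))
      else 0)"

definition meyer_phi :: "(real \<Rightarrow> real) \<Rightarrow> real \<Rightarrow> real \<Rightarrow> complex" where
  "meyer_phi \<theta> \<omega>0 = inv_fourier (\<lambda>\<omega>. complex_of_real (meyer_hat \<theta> \<omega>0 \<omega>))"

text \<open>Meyer mask: the 2 pi-periodic function equal to meyer_hat (2 w) on [-pi, pi]
  (the values at the endpoints agree, both being 0).\<close>
definition meyer_mask :: "(real \<Rightarrow> real) \<Rightarrow> real \<Rightarrow> real \<Rightarrow> real" where
  "meyer_mask \<theta> \<omega>0 \<omega> =
     meyer_hat \<theta> \<omega>0 (2 * (\<omega> - 2 * pi * real_of_int \<lfloor>(\<omega> + pi) / (2 * pi)\<rfloor>))"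

definition meyer_mask_l :: "(real \<Rightarrow> real) \<Rightarrow> real \<Rightarrow> nat \<Rightarrow> real \<Rightarrow> real" where
  "meyer_mask_l \<theta> \<omega>0 l \<omega> = meyer_mask \<theta> \<omega>0 \<omega> / (cos (\<omega> / 2)) ^ (2 * l)"

definition Cnorm :: "(real \<Rightarrow> real) \<Rightarrow> real" where
  "Cnorm f = (SUP \<omega>\<in>{-pi..pi}. \<bar>f \<omega>\<bar>)"

definition four_a :: "(real \<Rightarrow> real) \<Rightarrow> nat \<Rightarrow> real" where
  "four_a f k = integral {-pi..pi} (\<lambda>t. f t * cos (real k * t)) / pi"

definition four_b :: "(real \<Rightarrow> real) \<Rightarrow> nat \<Rightarrow> real" where
  "four_b f k = integral {-pi..pi} (\<lambda>t. f t * sin (real k * t)) / pi"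

definition summ_method :: "(nat \<Rightarrow> nat \<Rightarrow> real) \<Rightarrow> nat \<Rightarrow> (real \<Rightarrow> real) \<Rightarrow> real \<Rightarrow> real" where
  "summ_method lam n f \<omega> = four_a f 0 / 2 +
     (\<Sum>k=1..n. lam n k * (four_a f k * cos (real k * \<omega>) + four_b f k * sin (real k * \<omega>)))"

definition u_l :: "(real \<Rightarrow> real) \<Rightarrow> real \<Rightarrow> (nat \<Rightarrow> nat \<Rightarrow> real) \<Rightarrow> (nat \<Rightarrow> nat) \<Rightarrow> nat \<Rightarrow> real \<Rightarrow> real" where
  "u_l \<theta> \<omega>0 lam nn l = summ_method lam (nn l) (meyer_mask_l \<theta> \<omega>0 l)"

definition u1_l :: "(real \<Rightarrow> real) \<Rightarrow> real \<Rightarrow> (nat \<Rightarrow> nat \<Rightarrow> real) \<Rightarrow> (nat \<Rightarrow> nat) \<Rightarrow> nat \<Rightarrow> real \<Rightarrow> real" where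
  "u1_l \<theta> \<omega>0 lam nn l = summ_method lam (nn l) (deriv (meyer_mask_l \<theta> \<omega>0 l))"

definition alpha_l :: "(real \<Rightarrow> real) \<Rightarrow> real \<Rightarrow> (nat \<Rightarrow> nat \<Rightarrow> real) \<Rightarrow> (nat \<Rightarrow> nat) \<Rightarrow> nat \<Rightarrow> real" where
  "alpha_l \<theta> \<omega>0 lam nn l = Cnorm (\<lambda>\<omega>. u_l \<theta> \<omega>0 lam nn l \<omega> - meyer_mask_l \<theta> \<omega>0 l \<omega>)"

definition gamma_l :: "(real \<Rightarrow> real) \<Rightarrow> real \<Rightarrow> (nat \<Rightarrow> nat \<Rightarrow> real) \<Rightarrow> (nat \<Rightarrow> nat) \<Rightarrow> nat \<Rightarrow> real" where
  "gamma_l \<theta> \<omega>0 lam nn l = Cnorm (\<lambda>\<omega>. u1_l \<theta> \<omega>0 lam nn l \<omega> - deriv (meyer_mask_l \<theta> \<omega>0 l) \<omega>)"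

definition eps_l :: "(real \<Rightarrow> real) \<Rightarrow> real \<Rightarrow> (nat \<Rightarrow> nat \<Rightarrow> real) \<Rightarrow> (nat \<Rightarrow> nat) \<Rightarrow> nat \<Rightarrow> real" where
  "eps_l \<theta> \<omega>0 lam nn l = alpha_l \<theta> \<omega>0 lam nn l / Cnorm (meyer_mask_l \<theta> \<omega>0 l)"

definition mu_l :: "(real \<Rightarrow> real) \<Rightarrow> real \<Rightarrow> (nat \<Rightarrow> nat \<Rightarrow> real) \<Rightarrow> (nat \<Rightarrow> nat) \<Rightarrow> nat \<Rightarrow> real" where
  "mu_l \<theta> \<omega>0 lam nn l = real l * alpha_l \<theta> \<omega>0 lam nn l + gamma_l \<theta> \<omega>0 lam nn l"

definition mask_l :: "(real \<Rightarrow> real) \<Rightarrow> real \<Rightarrow> (nat \<Rightarrow> nat \<Rightarrow> real) \<Rightarrow> (nat \<Rightarrow> nat) \<Rightarrow> nat \<Rightarrow> real \<Rightarrow> real" where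
  "mask_l \<theta> \<omega>0 lam nn l \<omega> =
     (cos (\<omega> / 2)) ^ (2 * l) * u_l \<theta> \<omega>0 lam nn l \<omega> / u_l \<theta> \<omega>0 lam nn l 0"

definition phi_hat_l :: "(real \<Rightarrow> real) \<Rightarrow> real \<Rightarrow> (nat \<Rightarrow> nat \<Rightarrow> real) \<Rightarrow> (nat \<Rightarrow> nat) \<Rightarrow> nat \<Rightarrow> real \<Rightarrow> real" where
  "phi_hat_l \<theta> \<omega>0 lam nn l \<omega> = (\<Prod>j. mask_l \<theta> \<omega>0 lam nn l (\<omega> / 2 ^ Suc j))"

definition Phi_l :: "(real \<Rightarrow> real) \<Rightarrow> real \<Rightarrow> (nat \<Rightarrow> nat \<Rightarrow> real) \<Rightarrow> (nat \<Rightarrow> nat) \<Rightarrow> nat \<Rightarrow> real \<Rightarrow> real" where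
  "Phi_l \<theta> \<omega>0 lam nn l \<omega> =
     (\<Sum>\<^sub>\<infinity>k\<in>(UNIV::int set). (phi_hat_l \<theta> \<omega>0 lam nn l (\<omega> + 2 * pi * real_of_int k))\<^sup>2)"

definition phi_orth_hat_l :: "(real \<Rightarrow> real) \<Rightarrow> real \<Rightarrow> (nat \<Rightarrow> nat \<Rightarrow> real) \<Rightarrow> (nat \<Rightarrow> nat) \<Rightarrow> nat \<Rightarrow> real \<Rightarrow> real" where
  "phi_orth_hat_l \<theta> \<omega>0 lam nn l \<omega> =
     phi_hat_l \<theta> \<omega>0 lam nn l \<omega> / sqrt (Phi_l \<theta> \<omega>0 lam nn l \<omega>)"

definition phi_orth_l :: "(real \<Rightarrow> real) \<Rightarrow> real \<Rightarrow> (nat \<Rightarrow> nat \<Rightarrow> real) \<Rightarrow> (nat \<Rightarrow> nat) \<Rightarrow> nat \<Rightarrow> real \<Rightarrow> complex" where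
  "phi_orth_l \<theta> \<omega>0 lam nn l =
     inv_fourier (\<lambda>\<omega>. complex_of_real (phi_orth_hat_l \<theta> \<omega>0 lam nn l \<omega>))"

definition C0_const :: "real \<Rightarrow> real" where
  "C0_const \<omega>0 = 32 * pi\<^sup>2 * exp (2 * \<omega>0) / 27"

end

theory Submission
  imports Defs "HOL-Probability.Characteristic_Functions" "HOL-Probability.Sinc_Integral"
begin

text \<open>Every Fourier transform in sight is real, so all time centres vanish and, by Plancherel's theorem,
  the squared time radius of a function with transform \<open>g\<close> is the quotient of the integrals of
  \<open>(g')\<^sup>2\<close> and \<open>g\<^sup>2\<close>. It is therefore enough to compare the transforms and their derivatives up to
  \<open>O(\<mu> / (1 + \<omega>\<^sup>2))\<close>, and the time radii then differ by \<open>O(\<mu>)\<close>.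

  The masks and their derivatives differ by \<open>O(\<mu>)\<close>, because the new mask minus the Meyer mask is
  \<open>(1 / u(0) - 1) m\<close> plus \<open>cos (\<omega> / 2) ^ (2 * l) (u - m\<^sub>l) / u(0)\<close>, where \<open>m\<close> is the Meyer mask and
  \<open>m\<^sub>l\<close> its quotient by the power of the cosine, and because summation commutes with differentiation.
  Near 0 the infinite product is the exponential of a sum of logarithms of size \<open>O(\<mu>)\<close>. Away from 0,
  halving the argument passes through a point with \<open>cos \<omega> \<le> - 1 / 2\<close>, where the Meyer mask vanishes and
  the new mask is \<open>O(\<mu> cos (\<omega> / 2) ^ 4)\<close>; a weight adapted to doubling turns this into quadratic decay.
  Finally, periodizing the square changes 1 into \<open>1 + O(\<mu>)\<close>, so orthogonalization preserves these
  estimates.\<close>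

section \<open>Continuously differentiable real functions\<close>

lemma C1_differentiable_on_iff_deriv:
  fixes f :: "real \<Rightarrow> real"
  shows "f C1_differentiable_on S \<longleftrightarrow>
    (\<forall>x\<in>S. (f has_real_derivative deriv f x) (at x)) \<and> continuous_on S (deriv f)"
proof
  assume "f C1_differentiable_on S"
  then obtain f' where f': "\<And>x. x \<in> S \<Longrightarrow> (f has_real_derivative f' x) (at x)" "continuous_on S f'"
    unfolding C1_differentiable_on_def has_real_derivative_iff_has_vector_derivative by blast
  moreover have "deriv f x = f' x" if "x \<in> S" for x
    using f'(1)[OF that] by (rule DERIV_imp_deriv)
  ultimately show "(\<forall>x\<in>S. (f has_real_derivative deriv f x) (at x)) \<and> continuous_on S (deriv f)"
    by (simp cong: continuous_on_cong)
qed (auto simp: C1_differentiable_on_def has_real_derivative_iff_has_vector_derivative)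

lemma C1_differentiable_onI:
  fixes f :: "real \<Rightarrow> real"
  assumes "\<And>x. x \<in> S \<Longrightarrow> (f has_real_derivative f' x) (at x)" "continuous_on S f'"
  shows "f C1_differentiable_on S"
  using assms unfolding C1_differentiable_on_def has_real_derivative_iff_has_vector_derivative
  by blast

lemma C1_differentiable_on_has_deriv:
  fixes f :: "real \<Rightarrow> real"
  assumes "f C1_differentiable_on S" "x \<in> S"
  shows "(f has_real_derivative deriv f x) (at x)"
  using assms by (simp add: C1_differentiable_on_iff_deriv)

lemma C1_differentiable_on_compose:
  fixes f g :: "real \<Rightarrow> real"
  assumes g: "g C1_differentiable_on T" and f: "f C1_differentiable_on S" and "f ` S \<subseteq> T"
  shows "(\<lambda>x. g (f x)) C1_differentiable_on S"
proof (rule C1_differentiable_onI)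
  show "((\<lambda>x. g (f x)) has_real_derivative deriv g (f x) * deriv f x) (at x)" if "x \<in> S" for x
    using assms that by (intro DERIV_chain2 C1_differentiable_on_has_deriv) auto
  show "continuous_on S (\<lambda>x. deriv g (f x) * deriv f x)"
    using assms C1_differentiable_imp_continuous_on[OF f]
    by (auto simp: C1_differentiable_on_iff_deriv intro!: continuous_on_mult
        intro: continuous_on_compose2)
qed

lemma C1_differentiable_on_cong:
  fixes f g :: "real \<Rightarrow> real"
  assumes "open S" "g C1_differentiable_on S" "\<And>x. x \<in> S \<Longrightarrow> f x = g x"
  shows "f C1_differentiable_on S"
proof (rule C1_differentiable_onI)
  show "(f has_real_derivative deriv g x) (at x)" if "x \<in> S" for x
    by (rule has_field_derivative_transform_within_open[OF
        C1_differentiable_on_has_deriv[OF assms(2) that] assms(1) that])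
      (simp add: assms(3))
  show "continuous_on S (deriv g)"
    using assms(2) by (simp add: C1_differentiable_on_iff_deriv)
qed

lemma C1_differentiable_on_open_cover:
  fixes f :: "real \<Rightarrow> real"
  assumes "\<And>x. x \<in> S \<Longrightarrow> \<exists>T. open T \<and> x \<in> T \<and> f C1_differentiable_on T"
  shows "f C1_differentiable_on S"
  unfolding C1_differentiable_on_iff_deriv
proof (intro conjI ballI continuous_at_imp_continuous_on)
  fix x assume "x \<in> S"
  then obtain T where T: "open T" "x \<in> T" "f C1_differentiable_on T" using assms by blast
  then show "(f has_real_derivative deriv f x) (at x)" by (intro C1_differentiable_on_has_deriv)
  show "isCont (deriv f) x"
    using T by (simp add: C1_differentiable_on_iff_deriv continuous_on_eq_continuous_at)
qed

lemma C1_differentiable_on_cos [derivative_intros]: "cos C1_differentiable_on S"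
  by (rule C1_differentiable_onI[where f' = "\<lambda>x. - sin x"])
    (auto intro!: derivative_eq_intros continuous_intros)

lemma C1_differentiable_on_ln: "ln C1_differentiable_on {0::real<..}"
  by (rule C1_differentiable_onI[where f' = "\<lambda>x. 1 / x"])
    (auto intro!: derivative_eq_intros continuous_intros)

lemma C1_differentiable_on_exp: "(exp :: real \<Rightarrow> real) C1_differentiable_on S"
  by (rule C1_differentiable_onI[where f' = exp])
    (auto intro!: derivative_eq_intros continuous_intros)

lemma C1_differentiable_on_power [derivative_intros]:
  fixes f :: "real \<Rightarrow> real"
  shows "f C1_differentiable_on S \<Longrightarrow> (\<lambda>x. f x ^ n) C1_differentiable_on S"
  by (induction n) (simp_all add: C1_differentiable_on_mult)

lemma C1_differentiable_on_divide [derivative_intros]: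
  fixes f g :: "real \<Rightarrow> real"
  assumes f: "f C1_differentiable_on S" and g: "g C1_differentiable_on S" and "\<And>x. x \<in> S \<Longrightarrow> g x \<noteq> 0"
  shows "(\<lambda>x. f x / g x) C1_differentiable_on S"
proof (rule C1_differentiable_onI)
  show "((\<lambda>x. f x / g x) has_real_derivative
      (deriv f x * g x - f x * deriv g x) / (g x * g x)) (at x)"
    if "x \<in> S" for x
    using assms that by (intro DERIV_divide C1_differentiable_on_has_deriv)
  show "continuous_on S (\<lambda>x. (deriv f x * g x - f x * deriv g x) / (g x * g x))"
    using assms C1_differentiable_imp_continuous_on[OF f] C1_differentiable_imp_continuous_on[OF g]
    by (auto simp: C1_differentiable_on_iff_deriv intro!: continuous_intros)
qed

lemma C1_differentiable_on_scale:
  fixes f :: "real \<Rightarrow> real"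
  assumes "f C1_differentiable_on UNIV"
  shows "(\<lambda>x. f (a * x)) C1_differentiable_on UNIV"
  by (rule C1_differentiable_on_compose[OF assms _ subset_UNIV]) (auto intro: derivative_intros)

lemma deriv_scale:
  fixes f :: "real \<Rightarrow> real"
  assumes "f C1_differentiable_on UNIV"
  shows "deriv (\<lambda>x. f (a * x)) x = a * deriv f (a * x)"
  using DERIV_chain2[OF C1_differentiable_on_has_deriv[OF assms UNIV_I] DERIV_cmult_Id]
  by (subst mult.commute) (rule DERIV_imp_deriv)

lemma C1_differentiable_on_suminf:
  fixes f :: "nat \<Rightarrow> real \<Rightarrow> real"
  assumes S: "open S" "convex S" and f: "\<And>n. f n C1_differentiable_on S"
    and bound: "\<And>n x. x \<in> S \<Longrightarrow> \<bar>deriv (f n) x\<bar> \<le> c n" and c: "summable c"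
    and x0: "x0 \<in> S" "summable (\<lambda>n. f n x0)"
  shows "(\<lambda>x. \<Sum>n. f n x) C1_differentiable_on S"
    and "x \<in> S \<Longrightarrow> summable (\<lambda>n. f n x)"
    and "x \<in> S \<Longrightarrow> deriv (\<lambda>x. \<Sum>n. f n x) x = (\<Sum>n. deriv (f n) x)"
proof -
  have unif: "uniform_limit S (\<lambda>n x. \<Sum>i<n. deriv (f i) x) (\<lambda>x. \<Sum>n. deriv (f n) x) sequentially"
    by (rule Weierstrass_m_test[OF _ c]) (simp add: bound)
  then have conv: "uniformly_convergent_on S (\<lambda>n x. \<Sum>i<n. deriv (f i) x)"
    by (auto simp: uniformly_convergent_on_def)
  have der: "(f n has_real_derivative deriv (f n) x) (at x within S)" if "x \<in> S" for n x
    using C1_differentiable_on_has_deriv[OF f that] by (rule has_field_derivative_at_within)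
  note series = has_field_derivative_series'[OF S(2) der conv x0]
  show "x \<in> S \<Longrightarrow> summable (\<lambda>n. f n x)"
    using series(1) S(1) by (simp add: interior_open)
  have D: "((\<lambda>x. \<Sum>n. f n x) has_real_derivative (\<Sum>n. deriv (f n) x)) (at x)" if "x \<in> S" for x
    using series(2) S(1) that by (simp add: interior_open)
  then show "x \<in> S \<Longrightarrow> deriv (\<lambda>x. \<Sum>n. f n x) x = (\<Sum>n. deriv (f n) x)"
    by (blast intro: DERIV_imp_deriv)
  have "continuous_on S (\<lambda>x. \<Sum>n. deriv (f n) x)"
    by (rule uniform_limit_theorem[OF _ unif])
      (use f in \<open>auto simp: C1_differentiable_on_iff_deriv
        intro!: always_eventually continuous_on_sum\<close>)
  with D show "(\<lambda>x. \<Sum>n. f n x) C1_differentiable_on S" by (rule C1_differentiable_onI)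
qed

lemma C1_differentiable_on_periodic:
  fixes f :: "real \<Rightarrow> real"
  assumes "periodic_fun_simple f p" and f: "f C1_differentiable_on S" "open S"
    and "\<And>x. \<exists>n. x + of_int n * p \<in> S"
  shows "f C1_differentiable_on UNIV"
proof (rule C1_differentiable_on_open_cover)
  interpret periodic_fun_simple f p by fact
  fix x
  obtain n where n: "x + of_int n * p \<in> S" using assms(4) by blast
  let ?T = "(\<lambda>x. x + of_int n * p) -` S"
  have "(\<lambda>x. f (x + of_int n * p)) C1_differentiable_on ?T"
    by (rule C1_differentiable_on_compose[OF f(1)]) (auto intro: derivative_intros)
  moreover have "open ?T" by (intro open_vimage f continuous_intros)
  ultimately show "\<exists>T. open T \<and> x \<in> T \<and> f C1_differentiable_on T"
    using n by (auto simp: plus_of_int)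
qed

lemma deriv_diff_C1:
  fixes f g :: "real \<Rightarrow> real"
  assumes "f C1_differentiable_on UNIV" "g C1_differentiable_on UNIV"
  shows "deriv (\<lambda>x. f x - g x) x = deriv f x - deriv g x"
  using assms[THEN C1_differentiable_on_has_deriv, of x] by (intro DERIV_imp_deriv DERIV_diff) auto

lemma deriv_eq_0_if_const_on:
  fixes f :: "real \<Rightarrow> real"
  assumes "(f has_real_derivative f') (at x)" "\<And>y. y \<in> S \<Longrightarrow> f y = c" "x \<in> S" "at x within S \<noteq> bot"
  shows "f' = 0"
proof (rule has_field_derivative_unique)
  show "(f has_real_derivative f') (at x within S)"
    using assms(1) by (rule has_field_derivative_at_within)
  show "(f has_real_derivative 0) (at x within S)"
    by (rule has_field_derivative_transform_within[where f = "\<lambda>_. c" and d = 1]) (use assms in auto)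
  show "at x within S \<noteq> bot"
    by (rule assms(4))
qed

lemma deriv_eq_0_if_const_outside:
  fixes f :: "real \<Rightarrow> real"
  assumes f: "f C1_differentiable_on UNIV" and const: "\<And>x. R \<le> \<bar>x\<bar> \<Longrightarrow> f x = c" and "R \<le> \<bar>x\<bar>"
  shows "deriv f x = 0"
proof -
  have D: "(f has_real_derivative deriv f x) (at x)"
    by (rule C1_differentiable_on_has_deriv[OF f]) simp
  consider "0 \<le> x" | "x \<le> 0" by linarith
  then show ?thesis
  proof cases
    case 1
    then have "f y = c" if "y \<in> {x..}" for y using assms(3) that by (intro const) auto
    from deriv_eq_0_if_const_on[where S = "{x..}", OF D this] show ?thesis
      by (simp add: at_within_Ici_at_right)
  next
    case 2
    then have "f y = c" if "y \<in> {..x}" for y using assms(3) that by (intro const) auto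
    from deriv_eq_0_if_const_on[where S = "{..x}", OF D this] show ?thesis
      by (simp add: at_within_Iic_at_left)
  qed
qed

lemma deriv_periodic:
  assumes "periodic_fun_simple f p"
  shows "periodic_fun_simple (deriv f) (p::real)"
proof
  have "(\<lambda>x. f (x + p)) = f" using assms by (auto simp: periodic_fun_simple_def)
  then show "deriv f (x + p) = deriv f x" for x
    by (simp add: deriv_def DERIV_shift)
qed

definition C1_dominated :: "(real \<Rightarrow> real) \<Rightarrow> (real \<Rightarrow> real) \<Rightarrow> bool" where
  "C1_dominated w f \<longleftrightarrow> f C1_differentiable_on UNIV \<and> (\<forall>x. \<bar>f x\<bar> \<le> w x \<and> \<bar>deriv f x\<bar> \<le> w x)"

abbreviation C1_bounded :: "real \<Rightarrow> (real \<Rightarrow> real) \<Rightarrow> bool" where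
  "C1_bounded K \<equiv> C1_dominated (\<lambda>_. K)"

abbreviation C1_quadratic_decay :: "real \<Rightarrow> (real \<Rightarrow> real) \<Rightarrow> bool" where
  "C1_quadratic_decay K \<equiv> C1_dominated (\<lambda>x. K / (1 + x\<^sup>2))"

lemma C1_dominatedD:
  assumes "C1_dominated w f"
  shows C1_dominated_C1: "f C1_differentiable_on UNIV"
    and C1_dominated_abs_le: "\<bar>f x\<bar> \<le> w x"
    and C1_dominated_abs_deriv_le: "\<bar>deriv f x\<bar> \<le> w x"
    and C1_dominated_has_deriv: "(f has_real_derivative deriv f x) (at x)"
    and C1_dominated_continuous_on: "continuous_on A f"
    and C1_dominated_continuous_on_deriv: "continuous_on A (deriv f)"
    and C1_dominated_nonneg: "0 \<le> w x"
proof -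
  show C1: "f C1_differentiable_on UNIV" and le: "\<bar>f x\<bar> \<le> w x" and "\<bar>deriv f x\<bar> \<le> w x"
    using assms by (auto simp: C1_dominated_def)
  show "0 \<le> w x" by (rule order_trans[OF abs_ge_zero le])
  show "(f has_real_derivative deriv f x) (at x)"
    by (rule C1_differentiable_on_has_deriv[OF C1]) simp
  show "continuous_on A f" "continuous_on A (deriv f)"
    using C1 C1_differentiable_imp_continuous_on[OF C1]
    by (auto simp: C1_differentiable_on_iff_deriv intro: continuous_on_subset)
qed

lemma C1_dominatedI:
  assumes "\<And>x. (f has_real_derivative f' x) (at x)" "continuous_on UNIV f'"
    and "\<And>x. \<bar>f x\<bar> \<le> w x" "\<And>x. \<bar>f' x\<bar> \<le> w x"
  shows "C1_dominated w f"
proof -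
  have "deriv f = f'" using assms(1) by (auto intro: DERIV_imp_deriv)
  then show ?thesis using assms unfolding C1_dominated_def by (auto intro: C1_differentiable_onI)
qed

lemma C1_dominated_mono:
  assumes "C1_dominated v f" "\<And>x. v x \<le> w x"
  shows "C1_dominated w f"
  using assms unfolding C1_dominated_def by (meson order_trans)

lemma C1_dominated_add:
  assumes f: "C1_dominated v f" and g: "C1_dominated w g"
  shows "C1_dominated (\<lambda>x. v x + w x) (\<lambda>x. f x + g x)"
proof (rule C1_dominatedI)
  note D = C1_dominatedD[OF f] C1_dominatedD[OF g]
  show "((\<lambda>x. f x + g x) has_real_derivative deriv f x + deriv g x) (at x)" for x
    by (intro DERIV_add D)
  show "continuous_on UNIV (\<lambda>x. deriv f x + deriv g x)" by (intro continuous_intros D)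
  show "\<bar>f x + g x\<bar> \<le> v x + w x" "\<bar>deriv f x + deriv g x\<bar> \<le> v x + w x" for x
    by (intro order_trans[OF abs_triangle_ineq] add_mono D)+
qed

lemma C1_dominated_cmult:
  assumes f: "C1_dominated w f"
  shows "C1_dominated (\<lambda>x. \<bar>c\<bar> * w x) (\<lambda>x. c * f x)"
proof (rule C1_dominatedI)
  note D = C1_dominatedD[OF f]
  show "((\<lambda>x. c * f x) has_real_derivative c * deriv f x) (at x)" for x by (intro DERIV_cmult D)
  show "continuous_on UNIV (\<lambda>x. c * deriv f x)" by (intro continuous_intros D)
  show "\<bar>c * f x\<bar> \<le> \<bar>c\<bar> * w x" "\<bar>c * deriv f x\<bar> \<le> \<bar>c\<bar> * w x" for x
    unfolding abs_mult by (intro mult_left_mono D abs_ge_zero)+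
qed

lemma C1_dominated_mult:
  assumes f: "C1_dominated v f" and g: "C1_dominated w g"
  shows "C1_dominated (\<lambda>x. 2 * (v x * w x)) (\<lambda>x. f x * g x)"
proof (rule C1_dominatedI)
  note D = C1_dominatedD[OF f] C1_dominatedD[OF g]
  show "((\<lambda>x. f x * g x) has_real_derivative deriv f x * g x + deriv g x * f x) (at x)" for x
    by (intro DERIV_mult D)
  show "continuous_on UNIV (\<lambda>x. deriv f x * g x + deriv g x * f x)" by (intro continuous_intros D)
  fix x
  have nonneg: "0 \<le> v x" "0 \<le> w x" by (rule C1_dominated_nonneg[OF f] C1_dominated_nonneg[OF g])+
  then have le: "\<bar>f x * g x\<bar> \<le> v x * w x" "\<bar>deriv f x * g x\<bar> \<le> v x * w x"
    "\<bar>deriv g x * f x\<bar> \<le> w x * v x"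
    unfolding abs_mult by (auto intro!: mult_mono D)
  then show "\<bar>f x * g x\<bar> \<le> 2 * (v x * w x)"
    using mult_nonneg_nonneg[OF nonneg] by linarith
  show "\<bar>deriv f x * g x + deriv g x * f x\<bar> \<le> 2 * (v x * w x)"
    using le abs_triangle_ineq[of "deriv f x * g x" "deriv g x * f x"] by (simp add: mult.commute)
qed

section \<open>Plancherel's theorem for the inverse Fourier transform\<close>

lemma integrable_mult_iexp:
  assumes "integrable lborel g"
  shows "integrable lborel (\<lambda>w. g w * iexp (t * w))"
proof (rule Bochner_Integration.integrable_bound[OF assms])
  have "(\<lambda>w. iexp (t * w)) \<in> borel_measurable lborel"
    by (simp add: borel_measurable_continuous_onI continuous_intros)
  then show "(\<lambda>w. g w * iexp (t * w)) \<in> borel_measurable lborel"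
    using borel_measurable_integrable[OF assms] by simp
qed (simp add: norm_mult)

lemma norm_inv_fourier_le:
  "cmod (inv_fourier g t) \<le> (LINT w|lborel. cmod (g w)) / (2 * pi)"
proof -
  have "cmod (LINT w|lborel. g w * iexp (t * w)) \<le> (LINT w|lborel. cmod (g w * iexp (t * w)))"
    by (rule integral_norm_bound)
  then show ?thesis by (simp add: inv_fourier_def norm_mult divide_right_mono)
qed

lemma borel_measurable_inv_fourier [measurable]:
  assumes [measurable]: "g \<in> borel_measurable borel"
  shows "inv_fourier g \<in> borel_measurable borel"
  unfolding inv_fourier_def[abs_def] by measurable

lemma borel_measurable_cnj [measurable]:
  "f \<in> borel_measurable M \<Longrightarrow> (\<lambda>x. cnj (f x)) \<in> borel_measurable M"
  by (rule borel_measurable_continuous_on[OF continuous_on_cnj[OF continuous_on_id]])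

lemma inv_fourier_parseval:
  assumes f: "integrable lborel f" and g: "integrable lborel g"
  shows "(LINT t|lborel. f t * cnj (inv_fourier g t)) =
      (LINT w|lborel. inv_fourier f (- w) * cnj (g w))"
proof -
  let ?F = "\<lambda>t w. f t * (cnj (g w) * iexp (- (t * w)))"
  have [measurable]: "f \<in> borel_measurable borel" "g \<in> borel_measurable borel"
    using f g by (auto dest: borel_measurable_integrable)
  have "case_prod ?F \<in> borel_measurable (lborel \<Otimes>\<^sub>M lborel)"
    by measurable
  then have int: "integrable (lborel \<Otimes>\<^sub>M lborel) (case_prod ?F)"
    by (intro lborel_pair.Fubini_integrable) (use f g in \<open>auto simp: norm_mult case_prod_beta
      intro!: integrable_mult_right
        integrable_mult_iexp[of "\<lambda>w. cnj (g w)" "- t" for t, simplified]\<close>)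
  have cnj_inv:
    "cnj (inv_fourier g t) = (1 / (2 * pi)) *\<^sub>R (LINT w|lborel. cnj (g w) * iexp (- (t * w)))" for t
    by (simp add: inv_fourier_def exp_cnj flip: Bochner_Integration.integral_cnj)
  have "(LINT t|lborel. f t * cnj (inv_fourier g t)) =
      (1 / (2 * pi)) *\<^sub>R (LINT t|lborel. LINT w|lborel. ?F t w)"
    by (simp add: cnj_inv flip: integral_scaleR_right integral_mult_right_zero)
  also have "\<dots> = (1 / (2 * pi)) *\<^sub>R (LINT w|lborel. LINT t|lborel. ?F t w)"
    unfolding lborel_pair.Fubini_integral[OF int] ..
  also have "\<dots> = (LINT w|lborel. inv_fourier f (- w) * cnj (g w))"
    by (simp add: inv_fourier_def mult_ac
        flip: integral_scaleR_right integral_mult_right_zero integral_mult_left_zero)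
  finally show ?thesis .
qed

lemma inv_fourier_gaussian:
  assumes "0 < d"
  shows "inv_fourier (\<lambda>t. complex_of_real (exp (- (d * t)\<^sup>2 / 2))) s =
      complex_of_real (normal_density 0 d s)"
proof -
  let ?f = "\<lambda>x. complex_of_real (std_normal_density x) * iexp (s / d * x)"
  have "exp (- (s / d)\<^sup>2 / 2) = char std_normal_distribution (s / d)"
    by (simp add: char_std_normal_distribution)
  also have "\<dots> = (LINT x|lborel. ?f x)"
    unfolding char_def by (subst integral_density) (auto simp: scaleR_conv_of_real)
  also have "\<dots> = d *\<^sub>R (LINT t|lborel. ?f (0 + d * t))"
    using assms by (subst lborel_integral_real_affine[where c = d and t = 0]) auto
  also have "(\<lambda>t. ?f (0 + d * t)) =
      (\<lambda>t. (1 / sqrt (2 * pi)) *\<^sub>R (exp (- (d * t)\<^sup>2 / 2) * iexp (s * t)))"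
    using assms by (simp add: std_normal_density_def fun_eq_iff scaleR_conv_of_real)
  finally have "(LINT t|lborel. complex_of_real (exp (- (d * t)\<^sup>2 / 2)) * iexp (s * t)) =
      complex_of_real (sqrt (2 * pi) / d * exp (- (s / d)\<^sup>2 / 2))"
    using assms by (simp add: scaleR_conv_of_real field_simps)
  moreover have "1 / (2 * pi) * (sqrt (2 * pi) / d * exp (- (s / d)\<^sup>2 / 2)) = normal_density 0 d s"
  proof -
    define r where "r = sqrt (2 * pi)"
    have "r * r = 2 * pi" "r \<noteq> 0" by (simp_all add: r_def flip: power2_eq_square)
    moreover have "sqrt (2 * pi * d\<^sup>2) = r * d" using assms by (simp add: r_def real_sqrt_mult)
    ultimately show ?thesis unfolding normal_density_def r_def[symmetric]
      using assms by (simp add: power_divide field_simps)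
  qed
  ultimately show ?thesis by (simp only: inv_fourier_def scaleR_conv_of_real flip: of_real_mult)
qed

lemma integrable_gaussian:
  fixes d :: real
  assumes "0 < d"
  shows "integrable lborel (\<lambda>t. exp (- (d * t)\<^sup>2 / 2))"
proof -
  have "integrable lborel (\<lambda>t. sqrt (2 * pi) / d * normal_density 0 (1 / d) t)"
    using assms by (intro integrable_mult_right) simp
  moreover have "sqrt (2 * pi) / d * normal_density 0 (1 / d) t = exp (- (d * t)\<^sup>2 / 2)" for t
    using assms
    by (simp add: normal_density_def power_divide real_sqrt_divide real_sqrt_mult
        power_mult_distrib)
  ultimately show ?thesis by (simp only:)
qed

lemma inv_fourier_gaussian_mult:
  assumes g: "integrable lborel g" and d: "0 < d"
  shows "inv_fourier (\<lambda>t. complex_of_real (exp (- (d * t)\<^sup>2 / 2)) * inv_fourier g t) (- v) =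
    (1 / (2 * pi)) *\<^sub>R (LINT w|lborel. normal_density v d w *\<^sub>R g w)"
proof -
  let ?\<phi> = "\<lambda>t. complex_of_real (exp (- (d * t)\<^sup>2 / 2))"
  have shift: "inv_fourier (\<lambda>t. ?\<phi> t * iexp (v * t)) (- w) = complex_of_real (normal_density v d w)"
    for w
  proof -
    have "inv_fourier (\<lambda>t. ?\<phi> t * iexp (v * t)) (- w) = inv_fourier ?\<phi> (v - w)"
    proof -
      have "iexp (v * t) * iexp (- w * t) = iexp ((v - w) * t)" for t
        by (simp add: algebra_simps flip: exp_add)
      then show ?thesis unfolding inv_fourier_def by (simp only: mult.assoc)
    qed
    then show ?thesis
      unfolding inv_fourier_gaussian[OF d] by (simp add: normal_density_def power2_commute)
  qed
  have "(LINT t|lborel. ?\<phi> t * iexp (v * t) * cnj (inv_fourier g t)) =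
      (LINT w|lborel. complex_of_real (normal_density v d w) * cnj (g w))"
    unfolding inv_fourier_parseval[OF
        integrable_mult_iexp[OF integrable_of_real[OF integrable_gaussian[OF d]]] g] shift ..
  then have "cnj (LINT t|lborel. ?\<phi> t * iexp (v * t) * cnj (inv_fourier g t)) =
      cnj (LINT w|lborel. complex_of_real (normal_density v d w) * cnj (g w))"
    by simp
  then show ?thesis
    unfolding inv_fourier_def[of "\<lambda>t. ?\<phi> t * inv_fourier g t"]
    by (simp add: exp_cnj scaleR_conv_of_real mult_ac flip: Bochner_Integration.integral_cnj)
qed

lemma integral_normal_density_affine:
  fixes g :: "real \<Rightarrow> 'a :: {banach, second_countable_topology}"
  assumes "0 < d"
  shows "(LINT w|lborel. normal_density v d w *\<^sub>R g w) =
      (LINT s|lborel. std_normal_density s *\<^sub>R g (v + d * s))"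
proof -
  have "normal_density v d (v + d * s) = std_normal_density s / d" for s
    using assms by (simp add: normal_density_def real_sqrt_mult power_mult_distrib)
  then show ?thesis
    using assms lborel_integral_real_affine[of d "\<lambda>w. normal_density v d w *\<^sub>R g w" v]
    unfolding integral_scaleR_right[symmetric] by simp
qed

lemma integral_normal_density_tendsto:
  fixes g :: "real \<Rightarrow> 'a :: {banach, second_countable_topology}"
  assumes cont: "continuous_on UNIV g" and bound: "\<And>x. norm (g x) \<le> C"
    and d: "\<And>n. 0 < d n" "d \<longlonglongrightarrow> 0"
  shows "(\<lambda>n. LINT w|lborel. normal_density v (d n) w *\<^sub>R g w) \<longlonglongrightarrow> g v"
proof -
  have [measurable]: "g \<in> borel_measurable borel" by (rule borel_measurable_continuous_onI[OF cont])
  have "(\<lambda>n. LINT s|lborel. std_normal_density s *\<^sub>R g (v + d n * s)) \<longlonglongrightarrow>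
      (LINT s|lborel. std_normal_density s *\<^sub>R g v)"
  proof (rule integral_dominated_convergence[where w = "\<lambda>s. std_normal_density s * C"])
    have "(\<lambda>n. g (v + d n * s)) \<longlonglongrightarrow> g (v + 0 * s)" for s
      by (intro continuous_on_tendsto_compose[OF cont] tendsto_intros d) auto
    then show "AE s in lborel. (\<lambda>n. std_normal_density s *\<^sub>R g (v + d n * s)) \<longlonglongrightarrow>
        std_normal_density s *\<^sub>R g v"
      by (intro AE_I2 tendsto_intros) simp
    show "AE s in lborel. norm (std_normal_density s *\<^sub>R g (v + d n * s)) \<le>
        std_normal_density s * C" for n
      using bound by (auto intro!: mult_left_mono)
  qed auto
  then show ?thesis unfolding integral_normal_density_affine[OF d(1)] by simp
qed

lemma norm_integral_normal_density_le:
  fixes g :: "real \<Rightarrow> 'a :: {banach, second_countable_topology}"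
  assumes [measurable]: "g \<in> borel_measurable borel" and "\<And>x. norm (g x) \<le> C" and "0 < d"
  shows "norm (LINT w|lborel. normal_density v d w *\<^sub>R g w) \<le> C"
proof -
  have int: "integrable lborel (\<lambda>w. normal_density v d w * C)" using assms(3) by simp
  have le: "norm (normal_density v d w *\<^sub>R g w) \<le> normal_density v d w * C" for w
    using assms(2) by (simp add: mult_left_mono)
  have "integrable lborel (\<lambda>w. normal_density v d w *\<^sub>R g w)"
    by (rule Bochner_Integration.integrable_bound[OF int])
      (use order_trans[OF le abs_ge_self] in auto)
  then have "norm (LINT w|lborel. normal_density v d w *\<^sub>R g w) \<le>
      (LINT w|lborel. normal_density v d w * C)"
    using int le by (rule Bochner_Integration.integral_norm_bound_integral)
  then show ?thesis using assms(3) by simp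
qed

lemma gaussian_norm_inv_fourier_square:
  assumes g: "integrable lborel g" and d: "0 < d"
  shows "integrable lborel (\<lambda>t. exp (- (d * t)\<^sup>2 / 2) * (cmod (inv_fourier g t))\<^sup>2)"
    and "complex_of_real (LINT t|lborel. exp (- (d * t)\<^sup>2 / 2) * (cmod (inv_fourier g t))\<^sup>2) =
      (LINT w|lborel. (LINT v|lborel. normal_density w d v *\<^sub>R g v) * cnj (g w)) / (2 * pi)"
proof -
  let ?\<phi> = "\<lambda>t. exp (- (d * t)\<^sup>2 / 2)"
  have [measurable]: "g \<in> borel_measurable borel" using borel_measurable_integrable[OF g] by simp
  define C where "C = (LINT w|lborel. cmod (g w)) / (2 * pi)"
  have bound: "cmod (inv_fourier g t) \<le> C" for t unfolding C_def by (rule norm_inv_fourier_le)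
  have C: "0 \<le> C" using norm_ge_zero bound[of 0] by (rule order_trans)
  have \<phi>: "integrable lborel ?\<phi>" by (rule integrable_gaussian[OF d])
  show "integrable lborel (\<lambda>t. ?\<phi> t * (cmod (inv_fourier g t))\<^sup>2)"
    by (rule Bochner_Integration.integrable_bound[OF integrable_mult_left[OF \<phi>, of "C\<^sup>2"]])
      (use bound C in \<open>auto intro!: mult_left_mono power_mono\<close>)
  have int': "integrable lborel (\<lambda>t. complex_of_real (?\<phi> t) * inv_fourier g t)"
    by (rule Bochner_Integration.integrable_bound[OF integrable_mult_left[OF \<phi>, of C]])
      (use bound C in \<open>auto simp: norm_mult intro!: mult_left_mono\<close>)
  have "complex_of_real (LINT t|lborel. ?\<phi> t * (cmod (inv_fourier g t))\<^sup>2) =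
      (LINT t|lborel. (?\<phi> t * inv_fourier g t) * cnj (inv_fourier g t))"
  proof -
    have "complex_of_real (?\<phi> t * (cmod (inv_fourier g t))\<^sup>2) =
        (?\<phi> t * inv_fourier g t) * cnj (inv_fourier g t)" for t
      by (simp only: of_real_mult complex_norm_square mult.assoc)
    then show ?thesis by (simp only: flip: integral_complex_of_real)
  qed
  also have "\<dots> =
      (LINT w|lborel. (1 / (2 * pi)) *\<^sub>R (LINT v|lborel. normal_density w d v *\<^sub>R g v) * cnj (g w))"
    unfolding inv_fourier_parseval[OF int' g] inv_fourier_gaussian_mult[OF g d] ..
  also have "\<dots> =
      (LINT w|lborel. (LINT v|lborel. normal_density w d v *\<^sub>R g v) * cnj (g w)) / (2 * pi)"
    by (simp add: scaleR_conv_of_real mult.assoc)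
  finally show "complex_of_real (LINT t|lborel. ?\<phi> t * (cmod (inv_fourier g t))\<^sup>2) = \<dots>" .
qed

lemma gaussian_norm_inv_fourier_square_tendsto:
  assumes g: "integrable lborel g" and cont: "continuous_on UNIV g" and bound: "\<And>x. cmod (g x) \<le> C"
    and d: "\<And>n. 0 < d n" "d \<longlonglongrightarrow> 0"
  shows "(\<lambda>n. LINT t|lborel. exp (- (d n * t)\<^sup>2 / 2) * (cmod (inv_fourier g t))\<^sup>2) \<longlonglongrightarrow>
      L2norm_sq g / (2 * pi)"
proof -
  let ?f = "\<lambda>n t. exp (- (d n * t)\<^sup>2 / 2) * (cmod (inv_fourier g t))\<^sup>2"
  let ?avg = "\<lambda>n w. LINT v|lborel. normal_density w (d n) v *\<^sub>R g v"
  have [measurable]: "g \<in> borel_measurable borel" by (rule borel_measurable_continuous_onI[OF cont])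
  have "(\<lambda>n. LINT w|lborel. ?avg n w * cnj (g w)) \<longlonglongrightarrow> (LINT w|lborel. g w * cnj (g w))"
  proof (rule integral_dominated_convergence[where w = "\<lambda>w. C * cmod (g w)"])
    show "AE w in lborel. (\<lambda>n. ?avg n w * cnj (g w)) \<longlonglongrightarrow> g w * cnj (g w)"
      by (intro AE_I2 tendsto_intros integral_normal_density_tendsto[OF cont bound d])
    show "AE w in lborel. cmod (?avg n w * cnj (g w)) \<le> C * cmod (g w)" for n
      by (auto simp: norm_mult intro!: mult_right_mono norm_integral_normal_density_le bound d)
    show "(\<lambda>w. ?avg n w * cnj (g w)) \<in> borel_measurable lborel" for n
      unfolding normal_density_def by measurable
  qed (use g in auto)
  also have "(LINT w|lborel. g w * cnj (g w)) = complex_of_real (L2norm_sq g)"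
    by (simp only: L2norm_sq_def flip: complex_norm_square integral_complex_of_real)
  finally have "(\<lambda>n. complex_of_real (LINT t|lborel. ?f n t)) \<longlonglongrightarrow>
      complex_of_real (L2norm_sq g) / (2 * pi)"
    unfolding gaussian_norm_inv_fourier_square(2)[OF g d(1)] by (intro tendsto_intros) simp_all
  then show ?thesis
    using tendsto_of_real_iff[of "\<lambda>n. LINT t|lborel. ?f n t" "L2norm_sq g / (2 * pi)" sequentially,
        where 'a = complex]
    by simp
qed

theorem plancherel:
  assumes g: "integrable lborel g" and cont: "continuous_on UNIV g" and bound: "\<And>x. cmod (g x) \<le> C"
  shows "integrable lborel (\<lambda>t. (cmod (inv_fourier g t))\<^sup>2)"
    and "L2norm_sq (inv_fourier g) = L2norm_sq g / (2 * pi)"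
proof -
  define d :: "nat \<Rightarrow> real" where "d n = 1 / real (Suc n)" for n
  let ?f = "\<lambda>n t. exp (- (d n * t)\<^sup>2 / 2) * (cmod (inv_fourier g t))\<^sup>2"
  have d: "0 < d n" for n by (simp add: d_def)
  have d_lim: "d \<longlonglongrightarrow> 0" unfolding d_def by (rule LIMSEQ_Suc[OF lim_1_over_n])
  have [measurable]: "g \<in> borel_measurable borel" by (rule borel_measurable_continuous_onI[OF cont])
  have mono: "mono (\<lambda>n. ?f n t)" for t
  proof (intro monoI mult_right_mono)
    fix i j :: nat assume "i \<le> j"
    then have "(d j)\<^sup>2 * t\<^sup>2 \<le> (d i)\<^sup>2 * t\<^sup>2"
      by (intro mult_right_mono power_mono) (simp_all add: d_def frac_le)
    then show "exp (- (d i * t)\<^sup>2 / 2) \<le> exp (- (d j * t)\<^sup>2 / 2)"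
      by (simp add: power_mult_distrib)
  qed simp
  have "(\<lambda>n. ?f n t) \<longlonglongrightarrow> exp (- (0 * t)\<^sup>2 / 2) * (cmod (inv_fourier g t))\<^sup>2" for t
    by (intro tendsto_intros d_lim) auto
  then have pointwise: "(\<lambda>n. ?f n t) \<longlonglongrightarrow> (cmod (inv_fourier g t))\<^sup>2" for t by simp
  note monotone_convergence =
    integral_monotone_convergence_nonneg[OF gaussian_norm_inv_fourier_square(1)[OF g d]
      AE_I2[OF mono] _ AE_I2[OF pointwise] gaussian_norm_inv_fourier_square_tendsto[OF g cont bound d
          d_lim]]
  show "integrable lborel (\<lambda>t. (cmod (inv_fourier g t))\<^sup>2)"
    by (rule monotone_convergence(1)) auto
  show "L2norm_sq (inv_fourier g) = L2norm_sq g / (2 * pi)"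
    unfolding L2norm_sq_def[of "inv_fourier g"] by (rule monotone_convergence(2)) auto
qed

lemma integral_vector_derivative_eq_0:
  fixes F f :: "real \<Rightarrow> 'a :: euclidean_space"
  assumes deriv: "\<And>x. (F has_vector_derivative f x) (at x)" and cont: "\<And>x. isCont f x"
    and f: "integrable lborel f" and lim: "(F \<longlongrightarrow> 0) at_top" "(F \<longlongrightarrow> 0) at_bot"
  shows "(LINT x|lborel. f x) = 0"
proof -
  have "set_integrable lborel (einterval (- \<infinity>) \<infinity>) f"
    using f by (simp add: einterval_eq set_integrable_def)
  moreover have "((F \<circ> real_of_ereal) \<longlongrightarrow> 0) (at_right (- \<infinity>))"
    "((F \<circ> real_of_ereal) \<longlongrightarrow> 0) (at_left \<infinity>)"
    using lim by (simp_all add: ereal_tendsto_simps)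
  ultimately have "(LBINT x=-\<infinity>..\<infinity>. f x) = 0 - 0"
    by (intro interval_integral_FTC_integrable[where F = F] deriv cont) simp
  then show ?thesis
    by (simp add: interval_lebesgue_integral_def einterval_eq set_lebesgue_integral_def)
qed

lemma inv_fourier_vector_derivative:
  assumes deriv: "\<And>x. (g has_vector_derivative g' x) (at x)" and cont: "continuous_on UNIV g'"
    and g: "integrable lborel g" and g': "integrable lborel g'"
    and lim: "(g \<longlongrightarrow> 0) at_top" "(g \<longlongrightarrow> 0) at_bot"
  shows "inv_fourier g' t = - \<i> * complex_of_real t * inv_fourier g t"
proof -
  let ?F = "\<lambda>w. g w * iexp (t * w)"
  let ?f = "\<lambda>w. g' w * iexp (t * w) + \<i> * complex_of_real t * (g w * iexp (t * w))"
  note int = integrable_mult_iexp[OF g, of t] integrable_mult_iexp[OF g', of t]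
  have "(LINT x|lborel. ?f x) = 0"
  proof (rule integral_vector_derivative_eq_0[where F = ?F])
    fix x
    have "((\<lambda>w. t * w) has_vector_derivative t) (at x)"
      by (auto simp: has_real_derivative_iff_has_vector_derivative[symmetric]
          intro!: derivative_eq_intros)
    from vector_diff_chain_at[OF this has_vector_derivative_iexp]
    have "((\<lambda>w. iexp (t * w)) has_vector_derivative t *\<^sub>R (\<i> * iexp (t * x))) (at x)"
      by (simp add: o_def)
    from has_vector_derivative_mult[OF deriv this]
    show "(?F has_vector_derivative ?f x) (at x)"
      by (simp add: scaleR_conv_of_real algebra_simps)
    have "isCont g x" "isCont g' x"
      using has_vector_derivative_continuous[OF deriv] cont
      by (simp_all add: continuous_on_eq_continuous_at)
    then show "isCont ?f x" by (intro continuous_intros)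
  next
    show "integrable lborel ?f" using int by simp
    show "(?F \<longlongrightarrow> 0) at_top" "(?F \<longlongrightarrow> 0) at_bot"
      using lim
      unfolding tendsto_norm_zero_iff[of g, symmetric] tendsto_norm_zero_iff[of ?F, symmetric]
      by (simp_all add: norm_mult)
  qed
  then have "(LINT w|lborel. g' w * iexp (t * w)) =
      - (\<i> * complex_of_real t * (LINT w|lborel. g w * iexp (t * w)))"
    using int by (simp add: add_eq_0_iff2)
  then show ?thesis by (simp add: inv_fourier_def scaleR_conv_of_real)
qed

section \<open>Functions with quadratic decay and the time radius\<close>

lemma integrable_quadratic_decay: "integrable lborel (\<lambda>x::real. K / (1 + x\<^sup>2))"
  using integrable_mult_right[of K lborel "\<lambda>x. inverse (1 + x\<^sup>2)"] integrable_inverse_1_plus_square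
  by (simp add: einterval_eq set_integrable_def divide_inverse)

lemma quadratic_decay_le: "0 \<le> K \<Longrightarrow> K / (1 + x\<^sup>2) \<le> (K::real)"
  using divide_left_mono[of 1 "1 + x\<^sup>2" K] by (simp add: add_pos_nonneg)

lemma quadratic_decay_mult_le:
  fixes A B :: real
  assumes "0 \<le> A" "0 \<le> B"
  shows "A / (1 + x\<^sup>2) * (B / (1 + x\<^sup>2)) \<le> A * B / (1 + x\<^sup>2)"
  using mult_left_mono[OF quadratic_decay_le[OF assms(2), of x], of "A / (1 + x\<^sup>2)"] assms
  by (simp add: add_nonneg_nonneg)

lemma
  assumes f: "C1_quadratic_decay K f"
  shows C1_quadratic_decay_nonneg: "0 \<le> K"
    and C1_quadratic_decay_bounded: "C1_bounded K f"
    and C1_quadratic_decay_integrable: "integrable lborel f" "integrable lborel (deriv f)"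
    and C1_quadratic_decay_tendsto_0: "(f \<longlongrightarrow> 0) at_top" "(f \<longlongrightarrow> 0) at_bot"
proof -
  show K: "0 \<le> K" using C1_dominated_nonneg[OF f, of 0] by simp
  show "C1_bounded K f" by (rule C1_dominated_mono[OF f]) (rule quadratic_decay_le[OF K])
  have "continuous_on UNIV f" "continuous_on UNIV (deriv f)" using C1_dominatedD[OF f] by auto
  then have "f \<in> borel_measurable lborel" "deriv f \<in> borel_measurable lborel"
    by (simp_all add: borel_measurable_continuous_onI)
  moreover have "norm (f x) \<le> norm (K / (1 + x\<^sup>2))" "norm (deriv f x) \<le> norm (K / (1 + x\<^sup>2))" for x
    using order_trans[OF C1_dominated_abs_le[OF f] abs_ge_self]
      order_trans[OF C1_dominated_abs_deriv_le[OF f] abs_ge_self] by simp_all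
  ultimately show "integrable lborel f" "integrable lborel (deriv f)"
    by (auto intro: Bochner_Integration.integrable_bound[OF integrable_quadratic_decay[of K]])
  have "((\<lambda>x::real. K / (1 + x\<^sup>2)) \<longlongrightarrow> 0) at_top" "((\<lambda>x::real. K / (1 + x\<^sup>2)) \<longlongrightarrow> 0) at_bot"
    by (intro tendsto_divide_0[OF tendsto_const] filterlim_at_top_imp_at_infinity
        filterlim_tendsto_add_at_top[OF tendsto_const] filterlim_pow_at_top
        filterlim_pow_at_bot_even
        filterlim_ident; simp)+
  then show "(f \<longlongrightarrow> 0) at_top" "(f \<longlongrightarrow> 0) at_bot"
    using C1_dominated_abs_le[OF f] by (auto intro!: Lim_null_comparison[of f "\<lambda>x. K / (1 + x\<^sup>2)"])
qed

lemma C1_quadratic_decay_mult: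
  assumes f: "C1_quadratic_decay A f" and g: "C1_bounded B g"
  shows "C1_quadratic_decay (2 * A * B) (\<lambda>x. f x * g x)"
  using C1_dominated_mult[OF assms] by (simp add: mult.assoc)

lemma C1_quadratic_decay_add:
  assumes "C1_quadratic_decay A f" "C1_quadratic_decay B g"
  shows "C1_quadratic_decay (A + B) (\<lambda>x. f x + g x)"
  using C1_dominated_add[OF assms] by (simp add: add_divide_distrib)

lemma inv_fourier_minus_of_real:
  "inv_fourier (\<lambda>w. complex_of_real (f w)) (- t) = cnj (inv_fourier (\<lambda>w. complex_of_real (f w)) t)"
  by (simp add: inv_fourier_def exp_cnj flip: Bochner_Integration.integral_cnj)

abbreviation hat_radius_sq :: "(real \<Rightarrow> real) \<Rightarrow> real" where
  "hat_radius_sq f \<equiv> time_radius_sq (inv_fourier (\<lambda>w. complex_of_real (f w)))"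

theorem hat_radius_sq_eq:
  assumes f: "C1_quadratic_decay K f"
  shows "hat_radius_sq f = (LINT x|lborel. (deriv f x)\<^sup>2) / (LINT x|lborel. (f x)\<^sup>2)"
proof -
  let ?F = "inv_fourier (\<lambda>w. complex_of_real (f w))"
    and ?F' = "inv_fourier (\<lambda>w. complex_of_real (deriv f w))"
  note bounded = C1_quadratic_decay_bounded[OF f]
  have "cmod (?F (- t)) = cmod (?F t)" for t by (simp add: inv_fourier_minus_of_real)
  then have centre: "time_centre ?F = 0"
    using lborel_integral_real_affine[of "-1" "\<lambda>t. t * (cmod (?F t))\<^sup>2" 0]
    by (simp add: time_centre_def)
  have "((\<lambda>w. complex_of_real (f w)) has_vector_derivative complex_of_real (deriv f x)) (at x)"
    for x
    using C1_dominated_has_deriv[OF f]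
    by (intro has_vector_derivative_of_real)
      (simp add: has_real_derivative_iff_has_vector_derivative)
  then have "?F' t = - \<i> * complex_of_real t * ?F t" for t
    using C1_quadratic_decay_integrable[OF f] C1_quadratic_decay_tendsto_0[OF f]
    by (intro inv_fourier_vector_derivative integrable_of_real continuous_on_of_real
        C1_dominated_continuous_on_deriv[OF f])
      (auto intro: tendsto_of_real[where 'a = complex and a = 0, simplified])
  then have "t\<^sup>2 * (cmod (?F t))\<^sup>2 = (cmod (?F' t))\<^sup>2" for t
    by (simp add: norm_mult power_mult_distrib)
  moreover have "L2norm_sq ?F = L2norm_sq (\<lambda>w. complex_of_real (f w)) / (2 * pi)"
    "L2norm_sq ?F' = L2norm_sq (\<lambda>w. complex_of_real (deriv f w)) / (2 * pi)"
    using C1_dominated_abs_le[OF bounded] C1_dominated_abs_deriv_le[OF bounded]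
    by (intro plancherel(2)[where C = K] integrable_of_real continuous_on_of_real
        C1_quadratic_decay_integrable[OF f] C1_dominated_continuous_on[OF f]
        C1_dominated_continuous_on_deriv[OF f]; simp)+
  ultimately show ?thesis
    unfolding time_radius_sq_def centre by (simp add: L2norm_sq_def)
qed

lemma integrable_square_quadratic_decay:
  fixes f :: "real \<Rightarrow> real"
  assumes [measurable]: "f \<in> borel_measurable borel" and bound: "\<And>x. \<bar>f x\<bar> \<le> C / (1 + x\<^sup>2)"
  shows "integrable lborel (\<lambda>x. (f x)\<^sup>2)"
proof (rule Bochner_Integration.integrable_bound[OF integrable_quadratic_decay[of "C * C"]])
  have C: "0 \<le> C" using bound[of 0] by simp
  have "\<bar>f x\<bar> * \<bar>f x\<bar> \<le> C * C / (1 + x\<^sup>2)" for x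
    using mult_mono[OF bound[of x] bound[of x]] quadratic_decay_mult_le[OF C C, of x] C
    by (simp add: add_nonneg_nonneg)
  then show "AE x in lborel. norm ((f x)\<^sup>2) \<le> norm (C * C / (1 + x\<^sup>2))"
    by (simp add: power2_eq_square abs_mult order_trans[OF _ abs_ge_self])
qed simp

lemma integral_square_diff_le:
  fixes f h :: "real \<Rightarrow> real"
  assumes [measurable]: "f \<in> borel_measurable borel" "h \<in> borel_measurable borel"
    and diff: "\<And>x. \<bar>f x - h x\<bar> \<le> D / (1 + x\<^sup>2)" and h: "\<And>x. \<bar>h x\<bar> \<le> K / (1 + x\<^sup>2)"
  shows "\<bar>(LINT x|lborel. (f x)\<^sup>2) - (LINT x|lborel. (h x)\<^sup>2)\<bar> \<le> pi * (D * (D + 2 * K))"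
proof -
  have nonneg: "0 \<le> D" "0 \<le> K" using diff[of 0] h[of 0] by simp_all
  have f: "\<bar>f x\<bar> \<le> (D + K) / (1 + x\<^sup>2)" for x
    using diff[of x] h[of x] by (simp add: add_divide_distrib)
  have int: "integrable lborel (\<lambda>x. (f x)\<^sup>2)" "integrable lborel (\<lambda>x. (h x)\<^sup>2)"
    using integrable_square_quadratic_decay[OF _ f] integrable_square_quadratic_decay[OF _ h]
    by simp_all
  have "\<bar>(f x)\<^sup>2 - (h x)\<^sup>2\<bar> \<le> D * (D + 2 * K) * (1 / (1 + x\<^sup>2))" for x
  proof -
    have "\<bar>f x + h x\<bar> \<le> (D + 2 * K) / (1 + x\<^sup>2)"
      using abs_triangle_ineq[of "f x" "h x"] f[of x] h[of x] by (simp add: add_divide_distrib)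
    then have "\<bar>f x - h x\<bar> * \<bar>f x + h x\<bar> \<le> D / (1 + x\<^sup>2) * ((D + 2 * K) / (1 + x\<^sup>2))"
      using diff nonneg by (intro mult_mono) auto
    also have "\<dots> \<le> D * (D + 2 * K) / (1 + x\<^sup>2)"
      using nonneg by (intro quadratic_decay_mult_le) auto
    finally have "\<bar>(f x - h x) * (f x + h x)\<bar> \<le> D * (D + 2 * K) / (1 + x\<^sup>2)" by (simp add: abs_mult)
    moreover have "(f x - h x) * (f x + h x) = (f x)\<^sup>2 - (h x)\<^sup>2"
      by (simp add: power2_eq_square algebra_simps)
    ultimately show ?thesis by simp
  qed
  then have "\<bar>LINT x|lborel. (f x)\<^sup>2 - (h x)\<^sup>2\<bar> \<le>
      (LINT x|lborel. D * (D + 2 * K) * (1 / (1 + x\<^sup>2)))"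
    using int integrable_quadratic_decay[of "D * (D + 2 * K)"]
    by (intro Bochner_Integration.integral_abs_bound_integral) auto
  also have "\<dots> = D * (D + 2 * K) * pi"
    unfolding integral_mult_right_zero using LBINT_inverse_1_plus_square
    by (simp add: interval_lebesgue_integral_def set_lebesgue_integral_def einterval_eq
        inverse_eq_divide)
  finally show ?thesis
    unfolding Bochner_Integration.integral_diff[OF int] by (simp add: mult.commute)
qed

lemma quotient_diff_le:
  fixes a b a' b' r :: real
  assumes a: "\<bar>a - a'\<bar> \<le> r" and b: "\<bar>b - b'\<bar> \<le> r" and "0 < b'" "0 \<le> a'" "r \<le> b' / 2"
  shows "\<bar>a / b - a' / b'\<bar> \<le> r * (2 * (a' + b') / b'\<^sup>2)"
proof -
  have half: "b' / 2 \<le> b" using assms by linarith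
  have "a / b - a' / b' = ((a - a') * b' - a' * (b - b')) / (b * b')"
    using half assms(3) by (simp add: field_simps)
  moreover have "\<bar>(a - a') * b' - a' * (b - b')\<bar> \<le> r * b' + a' * r"
  proof -
    have "\<bar>(a - a') * b'\<bar> \<le> r * b'" "\<bar>a' * (b - b')\<bar> \<le> a' * r"
      using assms by (simp_all add: abs_mult mult_right_mono mult_left_mono)
    then show ?thesis by linarith
  qed
  ultimately have "\<bar>a / b - a' / b'\<bar> \<le> (r * b' + a' * r) / (b * b')"
    using half assms(3) by (simp add: abs_divide divide_right_mono)
  also have "\<dots> \<le> (r * b' + a' * r) / (b' / 2 * b')"
    using half assms abs_ge_zero[of "a - a'"]
    by (intro divide_left_mono mult_right_mono add_nonneg_nonneg mult_nonneg_nonneg mult_pos_pos)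
      linarith+
  also have "\<dots> = r * (2 * (a' + b') / b'\<^sup>2)"
    using assms(3) by (simp add: field_simps power2_eq_square)
  finally show ?thesis .
qed

lemma C1_quadratic_decay_integral_square_diff_le:
  assumes f: "C1_quadratic_decay A f" and h: "C1_quadratic_decay K h"
    and diff: "C1_quadratic_decay D (\<lambda>x. f x - h x)" and "D \<le> 1"
  shows "\<bar>(LINT x|lborel. (f x)\<^sup>2) - (LINT x|lborel. (h x)\<^sup>2)\<bar> \<le> pi * (1 + 2 * K) * D"
    and "\<bar>(LINT x|lborel. (deriv f x)\<^sup>2) - (LINT x|lborel. (deriv h x)\<^sup>2)\<bar>
      \<le> pi * (1 + 2 * K) * D"
proof -
  have deriv: "deriv (\<lambda>x. f x - h x) x = deriv f x - deriv h x" for x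
    by (intro deriv_diff_C1 C1_dominated_C1[OF f] C1_dominated_C1[OF h])
  have "pi * (D * (D + 2 * K)) \<le> pi * (D * (1 + 2 * K))"
    using C1_quadratic_decay_nonneg[OF diff] assms(4) by (intro mult_left_mono) auto
  then have le: "pi * (D * (D + 2 * K)) \<le> pi * (1 + 2 * K) * D" by (simp add: mult_ac)
  show "\<bar>(LINT x|lborel. (f x)\<^sup>2) - (LINT x|lborel. (h x)\<^sup>2)\<bar> \<le> pi * (1 + 2 * K) * D"
    "\<bar>(LINT x|lborel. (deriv f x)\<^sup>2) - (LINT x|lborel. (deriv h x)\<^sup>2)\<bar> \<le> pi * (1 + 2 * K) * D"
    by (intro order_trans[OF integral_square_diff_le le] borel_measurable_continuous_onI
        C1_dominated_abs_le[OF diff] C1_dominated_abs_deriv_le[OF diff, unfolded deriv]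
        C1_dominatedD[OF f] C1_dominatedD[OF h])+
qed

theorem hat_radius_sq_lipschitz:
  assumes H: "C1_quadratic_decay K H" and pos: "0 < (LINT x|lborel. (H x)\<^sup>2)"
  obtains \<delta> L where "0 < \<delta>" "0 \<le> L"
    "\<And>f D. \<lbrakk>C1_quadratic_decay D (\<lambda>x. f x - H x); D \<le> \<delta>\<rbrakk> \<Longrightarrow>
      \<bar>hat_radius_sq f - hat_radius_sq H\<bar> \<le> L * D"
proof -
  define a where "a = (LINT x|lborel. (deriv H x)\<^sup>2)"
  define b where "b = (LINT x|lborel. (H x)\<^sup>2)"
  define R where "R = pi * (1 + 2 * K)"
  have K: "0 \<le> K" by (rule C1_quadratic_decay_nonneg[OF H])
  have R: "0 < R" using K by (simp add: R_def)
  have ab: "0 \<le> a" "0 < b" using pos by (simp_all add: a_def b_def)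
  let ?\<delta> = "min 1 (b / (2 * R))" and ?L = "R * (2 * (a + b) / b\<^sup>2)"
  show ?thesis
  proof (rule that[of ?\<delta> ?L])
    show "0 < ?\<delta>" "0 \<le> ?L" using R ab by simp_all
    fix f D
    assume diff: "C1_quadratic_decay D (\<lambda>x. f x - H x)" and D: "D \<le> ?\<delta>"
    have f: "C1_quadratic_decay (D + K) f"
      using C1_quadratic_decay_add[OF diff H] by simp
    have "\<bar>(LINT x|lborel. (deriv f x)\<^sup>2) - a\<bar> \<le> R * D" "\<bar>(LINT x|lborel. (f x)\<^sup>2) - b\<bar> \<le> R * D"
      using C1_quadratic_decay_integral_square_diff_le[OF f H diff] D
      by (simp_all add: a_def b_def R_def)
    moreover have "R * D \<le> b / 2"
      using D R by (simp add: pos_le_divide_eq mult_ac)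
    ultimately have
      "\<bar>(LINT x|lborel. (deriv f x)\<^sup>2) / (LINT x|lborel. (f x)\<^sup>2) - a / b\<bar> \<le>
          R * D * (2 * (a + b) / b\<^sup>2)"
      using ab by (intro quotient_diff_le)
    then show "\<bar>hat_radius_sq f - hat_radius_sq H\<bar> \<le> ?L * D"
      unfolding hat_radius_sq_eq[OF f] hat_radius_sq_eq[OF H] a_def b_def by (simp only: mult_ac)
  qed
qed

section \<open>Periodization and orthogonalization\<close>

lemma int_shift_abs_le_pi: obtains n :: int where "\<bar>x + of_int n * (2 * pi)\<bar> \<le> pi"
proof
  have "\<bar>of_int (round (x / (2 * pi))) - x / (2 * pi)\<bar> * (2 * pi) \<le> 1 / 2 * (2 * pi)"
    by (intro mult_right_mono of_int_round_abs_le) simp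
  also have "\<bar>of_int (round (x / (2 * pi))) - x / (2 * pi)\<bar> * (2 * pi) =
      \<bar>of_int (round (x / (2 * pi))) * (2 * pi) - x\<bar>"
    by (simp add: abs_mult_pos left_diff_distrib)
  finally show "\<bar>x + of_int (- round (x / (2 * pi))) * (2 * pi)\<bar> \<le> pi" by simp
qed

lemma int_shift_abs_less_4: obtains n :: int where "\<bar>x + of_int n * (2 * pi)\<bar> < 4"
proof -
  obtain n :: int where "\<bar>x + of_int n * (2 * pi)\<bar> \<le> pi" by (rule int_shift_abs_le_pi)
  then show ?thesis using pi_less_4 by (intro that[of n]) linarith
qed

definition int_inverse_square_sum :: real where
  "int_inverse_square_sum = (\<Sum>\<^sub>\<infinity>k::int. 1 / (1 + (of_int k)\<^sup>2))"

lemma summable_on_int_inverse_square: "(\<lambda>k::int. 1 / (1 + (real_of_int k)\<^sup>2)) summable_on UNIV"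
proof -
  have "summable (\<lambda>n. norm (1 / (1 + (real n)\<^sup>2)))"
  proof (rule summable_comparison_test_ev[OF _ inverse_power_summable[of 2]])
    show "\<forall>\<^sub>F n in sequentially. norm (norm (1 / (1 + (real n)\<^sup>2))) \<le> inverse (real n ^ 2)"
      using eventually_gt_at_top[of 0]
      by eventually_elim (simp add: inverse_eq_divide frac_le add_nonneg_nonneg)
  qed simp
  then have nat: "(\<lambda>n. 1 / (1 + (real n)\<^sup>2)) summable_on UNIV"
    by (rule norm_summable_imp_summable_on)
  have "(\<lambda>k. 1 / (1 + (real_of_int k)\<^sup>2)) summable_on range int"
    using nat by (subst summable_on_reindex) (simp_all add: o_def)
  moreover have "(\<lambda>k. 1 / (1 + (real_of_int k)\<^sup>2)) summable_on range (\<lambda>n. - int n)"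
    using nat by (subst summable_on_reindex) (simp_all add: o_def inj_on_def)
  then have "(\<lambda>k. 1 / (1 + (real_of_int k)\<^sup>2)) summable_on (range (\<lambda>n. - int n) - range int)"
    by (rule summable_on_subset_banach) simp
  ultimately have
    "(\<lambda>k. 1 / (1 + (real_of_int k)\<^sup>2)) summable_on (range int \<union> (range (\<lambda>n. - int n) - range int))"
    by (rule summable_on_Un_disjoint) simp
  moreover have "range int \<union> (range (\<lambda>n. - int n) - range int) = UNIV"
    by (auto simp: image_iff) (metis int_cases2)
  ultimately show ?thesis by simp
qed

lemma int_inverse_square_sum_nonneg: "0 \<le> int_inverse_square_sum"
  unfolding int_inverse_square_sum_def by (intro infsum_nonneg) (simp add: add_nonneg_nonneg)

definition periodize :: "(real \<Rightarrow> real) \<Rightarrow> real \<Rightarrow> real" where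
  "periodize f x = (\<Sum>\<^sub>\<infinity>k::int. f (x + of_int k * (2 * pi)))"

lemma periodic_periodize: "periodic_fun_simple (periodize f) (2 * pi)"
proof
  have "bij_betw (\<lambda>k::int. k + 1) UNIV UNIV"
    by (rule bij_betwI[where g = "\<lambda>k. k - 1"]) auto
  from infsum_reindex_bij_betw[OF this, of "\<lambda>k. f (x + of_int k * (2 * pi))" for x]
  show "periodize f (x + 2 * pi) = periodize f x" for x
    by (simp add: periodize_def algebra_simps)
qed

lemma periodize_eq_single:
  assumes "\<And>y. r \<le> \<bar>y\<bar> \<Longrightarrow> f y = 0" and "\<bar>x\<bar> \<le> 2 * pi - r"
  shows "periodize f x = f x"
proof -
  have "periodize f x = (\<Sum>\<^sub>\<infinity>k\<in>{0}. f (x + of_int k * (2 * pi)))"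
    unfolding periodize_def
  proof (rule infsum_cong_neutral)
    fix k :: int assume "k \<in> UNIV - {0}"
    then have "1 * (2 * pi) \<le> \<bar>of_int k\<bar> * (2 * pi)" by (intro mult_right_mono) auto
    then have "r \<le> \<bar>x + of_int k * (2 * pi)\<bar>"
      using assms(2) abs_mult_pos[of "2 * pi" "real_of_int k"] by linarith
    then show "f (x + of_int k * (2 * pi)) = 0" by (rule assms(1))
  qed auto
  then show ?thesis by simp
qed

lemma inverse_square_int_shift_le:
  assumes "\<bar>x\<bar> < 4"
  shows "1 / (1 + (x + of_int k * (2 * pi))\<^sup>2) \<le> 1 / (1 + (real_of_int k)\<^sup>2)"
proof -
  have "\<bar>real_of_int k\<bar> \<le> \<bar>x + of_int k * (2 * pi)\<bar>"
  proof (cases "k = 0")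
    case False
    then have "1 \<le> \<bar>real_of_int k\<bar>" by linarith
    moreover have "\<bar>real_of_int k\<bar> * 6 \<le> \<bar>real_of_int k\<bar> * (2 * pi)"
      using pi_gt3 by (intro mult_left_mono) auto
    moreover have "\<bar>of_int k * (2 * pi)\<bar> = \<bar>real_of_int k\<bar> * (2 * pi)" by (simp add: abs_mult)
    ultimately show ?thesis using assms by linarith
  qed simp
  then have "(real_of_int k)\<^sup>2 \<le> (x + of_int k * (2 * pi))\<^sup>2" by (simp add: abs_le_square_iff)
  then show ?thesis by (intro divide_left_mono mult_pos_pos) (auto simp: add_pos_nonneg)
qed

context
  fixes f :: "real \<Rightarrow> real" and A :: real
  assumes decay: "\<And>x. \<bar>f x\<bar> \<le> A / (1 + x\<^sup>2)"
begin

lemma periodize_term_le: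
  assumes "\<bar>x\<bar> < 4"
  shows "\<bar>f (x + of_int k * (2 * pi))\<bar> \<le> A * (1 / (1 + (of_int k)\<^sup>2))"
proof -
  have "0 \<le> A" using decay[of 0] by simp
  from mult_left_mono[OF inverse_square_int_shift_le[OF assms] this]
  show ?thesis using decay[of "x + of_int k * (2 * pi)"] by (simp add: order_trans)
qed

lemma periodize_summable: "(\<lambda>k. f (x + of_int k * (2 * pi))) summable_on UNIV"
proof -
  obtain n where n: "\<bar>x + of_int n * (2 * pi)\<bar> < 4" by (rule int_shift_abs_less_4)
  have "bij_betw (\<lambda>k. k + n) UNIV UNIV"
    by (rule bij_betwI[where g = "\<lambda>k. k - n"]) auto
  from summable_on_reindex_bij_betw[OF this, of "\<lambda>k. f (x + of_int k * (2 * pi))"]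
  have "(\<lambda>k. f (x + of_int k * (2 * pi))) summable_on UNIV \<longleftrightarrow>
      (\<lambda>k. f (x + of_int n * (2 * pi) + of_int k * (2 * pi))) summable_on UNIV"
    by (simp add: algebra_simps)
  moreover have "(\<lambda>k. norm (f (x + of_int n * (2 * pi) + of_int k * (2 * pi)))) summable_on UNIV"
    using periodize_term_le[OF n]
    by (intro Infinite_Sum.abs_summable_on_comparison_test'[OF
        summable_on_cmult_right[OF summable_on_int_inverse_square, of A]]) simp
  ultimately show ?thesis by (simp add: abs_summable_summable)
qed

lemma abs_periodize_le: "\<bar>periodize f x\<bar> \<le> A * int_inverse_square_sum"
proof -
  interpret periodic_fun_simple "periodize f" "2 * pi" by (rule periodic_periodize)
  obtain n where n: "\<bar>x + of_int n * (2 * pi)\<bar> < 4" by (rule int_shift_abs_less_4)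
  have "norm (periodize f (x + of_int n * (2 * pi))) \<le> (\<Sum>\<^sub>\<infinity>k::int. A * (1 / (1 + (of_int k)\<^sup>2)))"
    unfolding periodize_def
    by (rule norm_infsum_le[OF has_sum_infsum[OF periodize_summable]
        has_sum_infsum[OF summable_on_cmult_right[OF summable_on_int_inverse_square]]])
      (use periodize_term_le[OF n] in simp)
  also have "\<dots> = A * int_inverse_square_sum"
    unfolding int_inverse_square_sum_def
    by (rule infsum_cmult_right) (rule summable_on_int_inverse_square)
  finally show ?thesis by (simp add: plus_of_int)
qed

lemma periodize_eq_suminf: "periodize f x = (\<Sum>j. f (x + of_int (int_decode j) * (2 * pi)))"
proof -
  have "(\<lambda>j. f (x + of_int (int_decode j) * (2 * pi))) summable_on UNIV"
    using summable_on_reindex_bij_betw[OF bij_int_decode, of "\<lambda>k. f (x + of_int k * (2 * pi))"]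
      periodize_summable[of x]
    by simp
  then have "(\<Sum>j. f (x + of_int (int_decode j) * (2 * pi))) =
      (\<Sum>\<^sub>\<infinity>j. f (x + of_int (int_decode j) * (2 * pi)))"
    by (intro sums_unique[symmetric] has_sum_imp_sums has_sum_infsum)
  then show ?thesis
    unfolding periodize_def
    using infsum_reindex_bij_betw[OF bij_int_decode, of "\<lambda>k. f (x + of_int k * (2 * pi))"] by simp
qed

end

lemma periodize_diff:
  assumes "\<And>x. \<bar>f x\<bar> \<le> A / (1 + x\<^sup>2)" "\<And>x. \<bar>h x\<bar> \<le> B / (1 + x\<^sup>2)"
  shows "periodize (\<lambda>x. f x - h x) x = periodize f x - periodize h x"
  unfolding periodize_def
  using infsum_add[OF periodize_summable[OF assms(1)]
      summable_on_uminus[THEN iffD2, OF periodize_summable[OF assms(2)]]]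
  by (simp add: infsum_uminus)

lemma
  assumes f: "C1_quadratic_decay A f"
  shows C1_periodize_near_0: "periodize f C1_differentiable_on {-4<..<4}"
    and deriv_periodize_near_0: "\<bar>x\<bar> < 4 \<Longrightarrow> deriv (periodize f) x = periodize (deriv f) x"
proof -
  let ?S = "{-4<..<4::real}" and ?f = "\<lambda>j x. f (x + of_int (int_decode j) * (2 * pi))"
  note le = C1_dominated_abs_le[OF f] and deriv_le = C1_dominated_abs_deriv_le[OF f]
  have f_j: "?f j C1_differentiable_on ?S" for j
    by (rule C1_differentiable_on_compose[OF C1_dominated_C1[OF f]]) (auto intro: derivative_intros)
  have deriv_f_j: "deriv (?f j) x = deriv f (x + of_int (int_decode j) * (2 * pi))" for j x
    using C1_dominated_has_deriv[OF f] by (intro DERIV_imp_deriv) (simp flip: DERIV_shift)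
  have summable: "summable (\<lambda>j. A * (1 / (1 + (real_of_int (int_decode j))\<^sup>2)))"
    using summable_on_reindex_bij_betw[OF bij_int_decode, of "\<lambda>k. 1 / (1 + (real_of_int k)\<^sup>2)"]
      summable_on_int_inverse_square
    by (intro summable_mult summable_on_imp_summable) simp
  have term_bound: "\<bar>deriv (?f j) x\<bar> \<le> A * (1 / (1 + (of_int (int_decode j))\<^sup>2))"
    if "x \<in> ?S" for j x
    unfolding deriv_f_j by (rule periodize_term_le[OF deriv_le]) (use that in auto)
  have zero: "0 \<in> ?S" by simp
  have summable_0: "summable (\<lambda>j. ?f j 0)"
    by (rule summable_comparison_test'[OF summable]) (use periodize_term_le[OF le, of 0] in simp)
  have "(\<lambda>x. \<Sum>j. ?f j x) C1_differentiable_on ?S"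
    and "x \<in> ?S \<Longrightarrow> deriv (\<lambda>x. \<Sum>j. ?f j x) x = (\<Sum>j. deriv (?f j) x)" for x
    by (rule C1_differentiable_on_suminf[OF open_greaterThanLessThan convex_real_interval(8) f_j
          term_bound summable zero summable_0]; assumption)+
  then show "periodize f C1_differentiable_on ?S"
    and "\<bar>x\<bar> < 4 \<Longrightarrow> deriv (periodize f) x = periodize (deriv f) x"
    unfolding periodize_eq_suminf[OF le, abs_def] periodize_eq_suminf[OF deriv_le] deriv_f_j
    by (simp_all add: abs_less_iff)
qed

lemma deriv_periodize:
  assumes f: "C1_quadratic_decay A f"
  shows "deriv (periodize f) = periodize (deriv f)"
proof
  interpret deriv_per: periodic_fun_simple "deriv (periodize f)" "2 * pi"
    by (rule deriv_periodic[OF periodic_periodize])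
  interpret per_deriv: periodic_fun_simple "periodize (deriv f)" "2 * pi"
    by (rule periodic_periodize)
  fix x
  obtain n where "\<bar>x + of_int n * (2 * pi)\<bar> < 4" by (rule int_shift_abs_less_4)
  from deriv_periodize_near_0[OF f this] show "deriv (periodize f) x = periodize (deriv f) x"
    by (simp add: deriv_per.plus_of_int per_deriv.plus_of_int)
qed

lemma C1_bounded_periodize:
  assumes f: "C1_quadratic_decay A f"
  shows "C1_bounded (A * int_inverse_square_sum) (periodize f)"
proof -
  have "\<exists>n. x + of_int n * (2 * pi) \<in> {-4<..<4}" for x
    using int_shift_abs_less_4[of x] by (metis abs_less_iff greaterThanLessThan_iff minus_less_iff)
  then have "periodize f C1_differentiable_on UNIV"
    by (rule C1_differentiable_on_periodic[OF periodic_periodize C1_periodize_near_0[OF f]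
        open_greaterThanLessThan])
  then show ?thesis
    unfolding C1_dominated_def deriv_periodize[OF f]
    using abs_periodize_le[OF C1_dominated_abs_le[OF f]]
      abs_periodize_le[OF C1_dominated_abs_deriv_le[OF f]] by simp
qed

definition orthogonalize :: "(real \<Rightarrow> real) \<Rightarrow> real \<Rightarrow> real" where
  "orthogonalize f x = f x / sqrt (periodize (\<lambda>x. (f x)\<^sup>2) x)"

lemma inverse_sqrt_near_1:
  fixes p d :: real
  assumes "\<bar>p - 1\<bar> \<le> d" "d \<le> 1 / 2"
  shows "1 / 4 \<le> p * sqrt p" "\<bar>1 / sqrt p - 1\<bar> \<le> 2 * d"
proof -
  have p: "1 / 2 \<le> p" using assms by linarith
  then have sqrt: "1 / 2 \<le> sqrt p" by (intro real_le_rsqrt) (simp add: power_divide)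
  have "1 / 2 * (1 / 2) \<le> p * sqrt p" using p sqrt by (intro mult_mono) auto
  then show "1 / 4 \<le> p * sqrt p" by simp
  have "1 / r - 1 = - (r * r - 1) / (r + r * r)" if "0 < r" for r :: real
    using that add_pos_pos[OF that mult_pos_pos[OF that that]] by (simp add: field_simps)
  from this[of "sqrt p"] have "\<bar>1 / sqrt p - 1\<bar> = \<bar>p - 1\<bar> / (sqrt p + p)"
    using p by (simp add: abs_divide abs_minus_commute)
  also have "\<dots> \<le> d / (1 / 2)"
    using assms(1) p sqrt order_trans[OF abs_ge_zero assms(1)] by (intro frac_le) auto
  finally show "\<bar>1 / sqrt p - 1\<bar> \<le> 2 * d" by simp
qed

lemma C1_bounded_inverse_sqrt:
  assumes p: "C1_bounded d (\<lambda>x. p x - 1)" and "d \<le> 1 / 2"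
  shows "C1_bounded (2 * d) (\<lambda>x. 1 / sqrt (p x) - 1)"
proof (rule C1_dominatedI)
  let ?p' = "deriv (\<lambda>x. p x - 1)"
  note near_1 = inverse_sqrt_near_1[OF C1_dominated_abs_le[OF p] assms(2)]
  have pos: "0 < p x" for x using C1_dominated_abs_le[OF p, of x] assms(2) by linarith
  have p': "(p has_real_derivative ?p' x) (at x)" for x
    using DERIV_add[OF C1_dominated_has_deriv[OF p] DERIV_const[of 1]] by simp
  have eq: "p x * sqrt (p x) = sqrt (p x) * sqrt (p x) * sqrt (p x)" for x
    using pos[of x] by simp
  show "((\<lambda>x. 1 / sqrt (p x) - 1) has_real_derivative - (?p' x / (2 * (p x * sqrt (p x))))) (at x)"
    for x
    using pos[of x] unfolding eq
    by (auto intro!: derivative_eq_intros p' simp: field_simps)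
  have "continuous_on UNIV p"
    using continuous_on_add[OF C1_dominated_continuous_on[OF p, of UNIV] continuous_on_const, of 1]
    by simp
  then show "continuous_on UNIV (\<lambda>x. - (?p' x / (2 * (p x * sqrt (p x)))))"
    using pos by (intro continuous_intros C1_dominated_continuous_on_deriv[OF p])
      (auto simp: less_imp_neq[symmetric])
  show "\<bar>1 / sqrt (p x) - 1\<bar> \<le> 2 * d" for x by (rule near_1(2))
  fix x
  have "\<bar>?p' x\<bar> / (2 * (p x * sqrt (p x))) \<le> d / (2 * (1 / 4))"
    using C1_dominated_abs_deriv_le[OF p] C1_dominated_nonneg[OF p]
    by (intro frac_le mult_left_mono near_1(1)) auto
  then show "\<bar>- (?p' x / (2 * (p x * sqrt (p x))))\<bar> \<le> 2 * d"
    using pos[of x] by (simp add: abs_divide abs_mult)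
qed

lemma C1_bounded_periodize_square_diff:
  assumes f: "C1_quadratic_decay K f" and h: "C1_quadratic_decay K h"
    and diff: "C1_quadratic_decay D (\<lambda>x. f x - h x)"
  shows "C1_bounded (4 * K * D * int_inverse_square_sum)
    (\<lambda>x. periodize (\<lambda>x. (f x)\<^sup>2) x - periodize (\<lambda>x. (h x)\<^sup>2) x)"
proof -
  note bounded = C1_quadratic_decay_bounded
  have square: "\<bar>(k x)\<^sup>2\<bar> \<le> 2 * K * K / (1 + x\<^sup>2)" if k: "C1_quadratic_decay K k" for k x
    using C1_dominated_abs_le[OF C1_quadratic_decay_mult[OF k bounded[OF k]], of x]
    by (simp add: power2_eq_square)
  have "(\<lambda>x. (f x - h x) * (f x + h x)) = (\<lambda>x. (f x)\<^sup>2 - (h x)\<^sup>2)"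
    by (simp add: fun_eq_iff power2_eq_square algebra_simps)
  then have "C1_quadratic_decay (2 * D * (K + K)) (\<lambda>x. (f x)\<^sup>2 - (h x)\<^sup>2)"
    using C1_quadratic_decay_mult[OF diff C1_dominated_add[OF bounded[OF f] bounded[OF h]]] by simp
  from C1_bounded_periodize[OF this] show ?thesis
    unfolding periodize_diff[OF square[OF f] square[OF h], abs_def] by (simp add: mult_ac)
qed

theorem orthogonalize_lipschitz:
  assumes H: "C1_quadratic_decay K H" and orth: "\<And>x. periodize (\<lambda>x. (H x)\<^sup>2) x = 1"
  obtains \<delta> L where "0 < \<delta>" "0 \<le> L"
    "\<And>f D. \<lbrakk>C1_quadratic_decay D (\<lambda>x. f x - H x); D \<le> \<delta>\<rbrakk> \<Longrightarrow>
      C1_quadratic_decay (L * D) (\<lambda>x. orthogonalize f x - H x)"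
proof -
  define C where "C = 4 * (K + 1) * int_inverse_square_sum"
  have K: "0 \<le> K" by (rule C1_quadratic_decay_nonneg[OF H])
  have C: "0 \<le> C" using K int_inverse_square_sum_nonneg by (simp add: C_def)
  let ?\<delta> = "1 / (2 * C + 1)" and ?L = "4 * (K + 1) * C + 1"
  show ?thesis
  proof (rule that[of ?\<delta> ?L])
    show "0 < ?\<delta>" "0 \<le> ?L" using K C by (simp_all add: add_nonneg_pos)
    fix f D
    assume diff: "C1_quadratic_decay D (\<lambda>x. f x - H x)" and D: "D \<le> ?\<delta>"
    have D0: "0 \<le> D" by (rule C1_quadratic_decay_nonneg[OF diff])
    have "D * (2 * C + 1) \<le> 1" using D C by (simp add: pos_le_divide_eq)
    moreover have "0 \<le> D * C" using C D0 by simp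
    ultimately have CD: "C * D \<le> 1 / 2" and D1: "D \<le> 1" using D0 by (simp_all add: algebra_simps)
    have "C1_quadratic_decay (D + K) f"
      using C1_quadratic_decay_add[OF diff H] by simp
    then have f: "C1_quadratic_decay (K + 1) f"
      by (rule C1_dominated_mono) (use D1 in \<open>simp add: divide_right_mono add_nonneg_nonneg\<close>)
    have "C1_quadratic_decay (K + 1) H"
      by (rule C1_dominated_mono[OF H]) (simp add: divide_right_mono add_nonneg_nonneg)
    from C1_bounded_periodize_square_diff[OF f this diff]
    have "C1_bounded (C * D) (\<lambda>x. periodize (\<lambda>x. (f x)\<^sup>2) x - 1)"
      by (simp add: orth C_def mult_ac)
    from C1_quadratic_decay_mult[OF f C1_bounded_inverse_sqrt[OF this CD]]
    have "C1_quadratic_decay (2 * (K + 1) * (2 * (C * D)) + D)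
        (\<lambda>x. f x * (1 / sqrt (periodize (\<lambda>x. (f x)\<^sup>2) x) - 1) + (f x - H x))"
      by (intro C1_quadratic_decay_add diff)
    then show "C1_quadratic_decay (?L * D) (\<lambda>x. orthogonalize f x - H x)"
      by (simp add: orthogonalize_def algebra_simps)
  qed
qed

theorem hat_radius_sq_orthogonalize_lipschitz:
  assumes H: "C1_quadratic_decay K H" and orth: "\<And>x. periodize (\<lambda>x. (H x)\<^sup>2) x = 1"
    and pos: "0 < (LINT x|lborel. (H x)\<^sup>2)"
  obtains \<delta> L where "0 < \<delta>" "0 \<le> L"
    "\<And>f D. \<lbrakk>C1_quadratic_decay D (\<lambda>x. f x - H x); D \<le> \<delta>\<rbrakk> \<Longrightarrow>
      \<bar>hat_radius_sq (orthogonalize f) - hat_radius_sq H\<bar> \<le> L * D"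
proof -
  obtain \<delta>\<^sub>1 L\<^sub>1 where radius: "0 < \<delta>\<^sub>1" "0 \<le> L\<^sub>1"
    "\<And>f D. \<lbrakk>C1_quadratic_decay D (\<lambda>x. f x - H x); D \<le> \<delta>\<^sub>1\<rbrakk> \<Longrightarrow>
      \<bar>hat_radius_sq f - hat_radius_sq H\<bar> \<le> L\<^sub>1 * D"
    using hat_radius_sq_lipschitz[OF H pos] by blast
  obtain \<delta>\<^sub>2 L\<^sub>2 where orthogonal: "0 < \<delta>\<^sub>2" "0 \<le> L\<^sub>2"
    "\<And>f D. \<lbrakk>C1_quadratic_decay D (\<lambda>x. f x - H x); D \<le> \<delta>\<^sub>2\<rbrakk> \<Longrightarrow>
      C1_quadratic_decay (L\<^sub>2 * D) (\<lambda>x. orthogonalize f x - H x)"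
    using orthogonalize_lipschitz[OF H orth] by blast
  show ?thesis
  proof (rule that[of "min \<delta>\<^sub>2 (\<delta>\<^sub>1 / (L\<^sub>2 + 1))" "L\<^sub>1 * L\<^sub>2"])
    show "0 < min \<delta>\<^sub>2 (\<delta>\<^sub>1 / (L\<^sub>2 + 1))" "0 \<le> L\<^sub>1 * L\<^sub>2"
      using radius(1,2) orthogonal(1,2) by simp_all
    fix f D
    assume diff: "C1_quadratic_decay D (\<lambda>x. f x - H x)" and D: "D \<le> min \<delta>\<^sub>2 (\<delta>\<^sub>1 / (L\<^sub>2 + 1))"
    have "0 \<le> D" by (rule C1_quadratic_decay_nonneg[OF diff])
    then have "L\<^sub>2 * D \<le> \<delta>\<^sub>1" using D orthogonal(2) by (simp add: pos_le_divide_eq algebra_simps)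
    with radius(3)[OF orthogonal(3)[OF diff]] D
    show "\<bar>hat_radius_sq (orthogonalize f) - hat_radius_sq H\<bar> \<le> L\<^sub>1 * L\<^sub>2 * D"
      by (simp add: mult.assoc)
  qed
qed

section \<open>Dyadic infinite products\<close>

lemma abs_dyadic_less:
  fixes x r :: real
  assumes "\<bar>x\<bar> < 2 * r"
  shows "\<bar>x / 2 ^ Suc j\<bar> < r"
proof -
  have "\<bar>x\<bar> / 2 ^ Suc j \<le> \<bar>x\<bar> / 2" by (intro divide_left_mono) simp_all
  then show ?thesis using assms by simp
qed

lemma
  fixes f :: "real \<Rightarrow> real"
  assumes f: "f C1_differentiable_on {-r<..<r}"
  shows C1_differentiable_on_dyadic_scale:
    "(\<lambda>x. f (x / 2 ^ Suc j)) C1_differentiable_on {-(2 * r)<..<2 * r}"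
    and deriv_dyadic_scale:
      "\<bar>x\<bar> < 2 * r \<Longrightarrow> deriv (\<lambda>x. f (x / 2 ^ Suc j)) x = deriv f (x / 2 ^ Suc j) / 2 ^ Suc j"
proof -
  have scaled: "x / 2 ^ Suc j \<in> {-r<..<r}" if "\<bar>x\<bar> < 2 * r" for x
    using abs_dyadic_less[OF that, of j] unfolding greaterThanLessThan_iff by linarith
  show "(\<lambda>x. f (x / 2 ^ Suc j)) C1_differentiable_on {-(2 * r)<..<2 * r}"
    by (rule C1_differentiable_on_compose[OF f])
      (auto intro!: derivative_intros scaled simp del: power_Suc)
  show "deriv (\<lambda>x. f (x / 2 ^ Suc j)) x = deriv f (x / 2 ^ Suc j) / 2 ^ Suc j" if "\<bar>x\<bar> < 2 * r"
    using DERIV_chain2[OF C1_differentiable_on_has_deriv[OF f scaled[OF that]]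
        DERIV_cdivide[OF DERIV_ident]]
    by (intro DERIV_imp_deriv) simp
qed

lemma dyadic_suminf:
  fixes L :: "real \<Rightarrow> real"
  assumes L: "L C1_differentiable_on {-r<..<r}" and L_0: "L 0 = 0" and r: "0 < r"
    and bound: "\<And>y. \<bar>y\<bar> < r \<Longrightarrow> \<bar>deriv L y\<bar> \<le> A"
  shows "(\<lambda>x. \<Sum>j. L (x / 2 ^ Suc j)) C1_differentiable_on {-(2 * r)<..<2 * r}"
    and "\<bar>x\<bar> < 2 * r \<Longrightarrow> summable (\<lambda>j. L (x / 2 ^ Suc j))"
    and "\<bar>x\<bar> < 2 * r \<Longrightarrow> \<bar>deriv (\<lambda>x. \<Sum>j. L (x / 2 ^ Suc j)) x\<bar> \<le> A"
    and "\<bar>x\<bar> < 2 * r \<Longrightarrow> \<bar>\<Sum>j. L (x / 2 ^ Suc j)\<bar> \<le> A * \<bar>x\<bar>"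
proof -
  let ?I = "{-(2 * r)<..<2 * r}" and ?L = "\<lambda>j x. L (x / 2 ^ Suc j)"
    and ?S = "\<lambda>x. \<Sum>j. L (x / 2 ^ Suc j)"
  have deriv_bound: "\<bar>deriv (?L j) x\<bar> \<le> A * (1 / 2) ^ Suc j" if "x \<in> ?I" for x j
  proof -
    have x: "\<bar>x\<bar> < 2 * r" using that by auto
    have "\<bar>deriv L (x / 2 ^ Suc j)\<bar> / 2 ^ Suc j \<le> A / 2 ^ Suc j"
      by (intro divide_right_mono bound abs_dyadic_less[OF x]) simp
    then show ?thesis unfolding deriv_dyadic_scale[OF L x] by (simp add: power_divide)
  qed
  have sums: "(\<lambda>j. A * (1 / 2) ^ Suc j) sums A" using sums_mult[OF power_half_series, of A] by simp
  have zero: "0 \<in> ?I" "summable (\<lambda>j. ?L j 0)" using r L_0 by simp_all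
  have C1: "?S C1_differentiable_on ?I"
    and summable: "x \<in> ?I \<Longrightarrow> summable (\<lambda>j. ?L j x)"
    and deriv: "x \<in> ?I \<Longrightarrow> deriv ?S x = (\<Sum>j. deriv (?L j) x)" for x
    by (rule C1_differentiable_on_suminf[OF open_greaterThanLessThan convex_real_interval(8)
          C1_differentiable_on_dyadic_scale[OF L] deriv_bound
          sums_summable[OF sums] zero]; assumption)+
  show "?S C1_differentiable_on ?I" by (rule C1)
  show "\<bar>x\<bar> < 2 * r \<Longrightarrow> summable (\<lambda>j. L (x / 2 ^ Suc j))" by (rule summable) auto
  show deriv_S: "\<bar>deriv ?S x\<bar> \<le> A" if "\<bar>x\<bar> < 2 * r" for x
  proof -
    have x: "x \<in> ?I" using that by auto
    have "norm (\<Sum>j. deriv (?L j) x) \<le> (\<Sum>j. A * (1 / 2) ^ Suc j)"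
      by (rule norm_suminf_le[OF _ sums_summable[OF sums]]) (use deriv_bound[OF x] in simp)
    then show ?thesis unfolding deriv[OF x] sums_unique[OF sums, symmetric] by simp
  qed
  have "norm (?S x - ?S 0) \<le> A * norm (x - 0)" if "\<bar>x\<bar> < 2 * r"
    by (rule field_differentiable_bound[where S = ?I and f' = "deriv ?S"])
      (use deriv_S that r C1_differentiable_on_has_deriv[OF C1] in
        \<open>auto intro: has_field_derivative_at_within\<close>)
  then show "\<bar>x\<bar> < 2 * r \<Longrightarrow> \<bar>?S x\<bar> \<le> A * \<bar>x\<bar>" using L_0 by simp
qed

lemma dyadic_exhaust: "\<exists>n. \<bar>x\<bar> < 2 ^ n * r" if "0 < r" for x r :: real
  using real_arch_pow[of 2 "\<bar>x\<bar> / r"] that by (auto simp: field_simps)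

definition dyadic_prod :: "(real \<Rightarrow> real) \<Rightarrow> real \<Rightarrow> real" where
  "dyadic_prod m x = (\<Prod>j. m (x / 2 ^ Suc j))"

locale C1_mask =
  fixes m :: "real \<Rightarrow> real"
  assumes C1_m: "m C1_differentiable_on UNIV" and m_0: "m 0 = 1"
begin

lemma m_has_deriv: "(m has_real_derivative deriv m x) (at x)"
  by (rule C1_differentiable_on_has_deriv[OF C1_m]) simp

context
  fixes r A :: real
  assumes r: "0 < r" and low: "\<bar>y\<bar> < r \<Longrightarrow> 1 / 2 \<le> m y" and bound: "\<bar>y\<bar> < r \<Longrightarrow> \<bar>deriv m y\<bar> \<le> A"
begin

lemma m_pos: "\<bar>y\<bar> < r \<Longrightarrow> 0 < m y"
  using low[of y] by linarith

lemma C1_ln_m: "(\<lambda>y. ln (m y)) C1_differentiable_on {-r<..<r}"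
  by (rule C1_differentiable_on_compose[OF C1_differentiable_on_ln
      C1_differentiable_on_subset[OF C1_m]])
    (use m_pos in \<open>auto simp: abs_less_iff\<close>)

lemma abs_deriv_ln_m_le:
  assumes "\<bar>y\<bar> < r"
  shows "\<bar>deriv (\<lambda>y. ln (m y)) y\<bar> \<le> 2 * A"
proof -
  have "deriv (\<lambda>y. ln (m y)) y = deriv m y / m y"
    using DERIV_chain2[OF DERIV_ln_divide[OF m_pos[OF assms]] m_has_deriv]
    by (intro DERIV_imp_deriv) simp
  moreover have "\<bar>deriv m y\<bar> / m y \<le> A / (1 / 2)"
    using low[OF assms] bound[OF assms] by (intro frac_le) auto
  ultimately show ?thesis using m_pos[OF assms] by (simp add: abs_divide)
qed

lemma ln_m_0: "ln (m 0) = 0"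
  by (simp add: m_0)

lemma
  shows C1_ln_sum: "(\<lambda>x. \<Sum>j. ln (m (x / 2 ^ Suc j))) C1_differentiable_on {-(2 * r)<..<2 * r}"
    and summable_ln: "\<bar>x\<bar> < 2 * r \<Longrightarrow> summable (\<lambda>j. ln (m (x / 2 ^ Suc j)))"
    and abs_deriv_ln_sum_le: "\<bar>x\<bar> < 2 * r \<Longrightarrow> \<bar>deriv (\<lambda>x. \<Sum>j. ln (m (x / 2 ^ Suc j))) x\<bar> \<le> 2 * A"
    and abs_ln_sum_le: "\<bar>x\<bar> < 2 * r \<Longrightarrow> \<bar>\<Sum>j. ln (m (x / 2 ^ Suc j))\<bar> \<le> 2 * A * \<bar>x\<bar>"
  by (rule dyadic_suminf[OF C1_ln_m ln_m_0 r abs_deriv_ln_m_le]; assumption)+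

lemma
  assumes x: "\<bar>x\<bar> < 2 * r"
  shows convergent_dyadic_prod_near_0: "convergent_prod (\<lambda>j. m (x / 2 ^ Suc j))"
    and dyadic_prod_eq_exp: "dyadic_prod m x = exp (\<Sum>j. ln (m (x / 2 ^ Suc j)))"
proof -
  have exp_ln: "m (x / 2 ^ Suc j) = exp (ln (m (x / 2 ^ Suc j)))" for j
    using m_pos[OF abs_dyadic_less[OF x]] by simp
  show "convergent_prod (\<lambda>j. m (x / 2 ^ Suc j))"
    by (subst exp_ln, rule convergent_prod_exp[OF summable_ln[OF x]])
  show "dyadic_prod m x = exp (\<Sum>j. ln (m (x / 2 ^ Suc j)))"
    unfolding dyadic_prod_def by (subst exp_ln, rule prodinf_exp[OF summable_ln[OF x]])
qed

lemma C1_dyadic_prod_near_0: "dyadic_prod m C1_differentiable_on {-(2 * r)<..<2 * r}"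
  by (rule C1_differentiable_on_cong[OF open_greaterThanLessThan
        C1_differentiable_on_compose[OF C1_differentiable_on_exp C1_ln_sum subset_UNIV]])
    (use dyadic_prod_eq_exp in \<open>simp add: abs_less_iff del: power_Suc\<close>)

lemma dyadic_prod_near_0_pos: "\<bar>x\<bar> < 2 * r \<Longrightarrow> 0 < dyadic_prod m x"
  by (simp add: dyadic_prod_eq_exp)

lemma abs_ln_dyadic_prod_le: "\<bar>x\<bar> < 2 * r \<Longrightarrow> \<bar>ln (dyadic_prod m x)\<bar> \<le> 2 * A * \<bar>x\<bar>"
  using abs_ln_sum_le[of x] by (simp add: dyadic_prod_eq_exp)

lemma abs_deriv_dyadic_prod_le:
  assumes x: "\<bar>x\<bar> < 2 * r"
  shows "\<bar>deriv (dyadic_prod m) x\<bar> \<le> 2 * A * dyadic_prod m x"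
proof -
  let ?S = "\<lambda>x. \<Sum>j. ln (m (x / 2 ^ Suc j))"
  have x': "x \<in> {-(2 * r)<..<2 * r}" using x by auto
  from DERIV_chain2[OF DERIV_exp C1_differentiable_on_has_deriv[OF C1_ln_sum x']]
  have "(dyadic_prod m has_real_derivative exp (?S x) * deriv ?S x) (at x)"
    by (rule has_field_derivative_transform_within_open[OF _ open_greaterThanLessThan x'])
      (use dyadic_prod_eq_exp in \<open>simp add: abs_less_iff del: power_Suc\<close>)
  then have "deriv (dyadic_prod m) x = dyadic_prod m x * deriv ?S x"
    unfolding dyadic_prod_eq_exp[OF x] by (rule DERIV_imp_deriv)
  then show ?thesis
    using mult_left_mono[OF abs_deriv_ln_sum_le[OF x], of "dyadic_prod m x"]
      dyadic_prod_near_0_pos[OF x]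
    by (simp add: abs_mult mult.commute)
qed

end

lemma near_0_bounds:
  obtains r A where "0 < r" "\<And>y. \<bar>y\<bar> < r \<Longrightarrow> 1 / 2 \<le> m y" "\<And>y. \<bar>y\<bar> < r \<Longrightarrow> \<bar>deriv m y\<bar> \<le> A"
proof -
  have "isCont m 0" "isCont (deriv m) 0"
    using C1_m DERIV_isCont[OF m_has_deriv]
    by (auto simp: C1_differentiable_on_iff_deriv continuous_on_eq_continuous_at)
  then have "(m \<longlongrightarrow> 1) (nhds 0)" "((\<lambda>y. \<bar>deriv m y\<bar>) \<longlongrightarrow> \<bar>deriv m 0\<bar>) (nhds 0)"
    unfolding isCont_def tendsto_at_iff_tendsto_nhds by (auto intro: tendsto_rabs simp: m_0)
  then have "\<forall>\<^sub>F y in nhds 0. 1 / 2 < m y" "\<forall>\<^sub>F y in nhds 0. \<bar>deriv m y\<bar> < \<bar>deriv m 0\<bar> + 1"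
    by (auto dest!: order_tendstoD(1)[of m _ _ "1 / 2"]
        order_tendstoD(2)[of "\<lambda>y. \<bar>deriv m y\<bar>" _ _ "\<bar>deriv m 0\<bar> + 1"])
  then have "\<forall>\<^sub>F y in nhds 0. 1 / 2 \<le> m y \<and> \<bar>deriv m y\<bar> \<le> \<bar>deriv m 0\<bar> + 1"
    by eventually_elim simp
  then obtain r where "0 < r" "\<And>y. \<bar>y\<bar> < r \<Longrightarrow> 1 / 2 \<le> m y \<and> \<bar>deriv m y\<bar> \<le> \<bar>deriv m 0\<bar> + 1"
    unfolding eventually_nhds_metric by (auto simp: dist_real_def)
  then show ?thesis using that[of r "\<bar>deriv m 0\<bar> + 1"] by blast
qed

lemma convergent_dyadic_prod: "convergent_prod (\<lambda>j. m (x / 2 ^ Suc j))"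
proof -
  obtain r A where r: "0 < r" "\<And>y. \<bar>y\<bar> < r \<Longrightarrow> 1 / 2 \<le> m y" "\<And>y. \<bar>y\<bar> < r \<Longrightarrow> \<bar>deriv m y\<bar> \<le> A"
    using near_0_bounds by blast
  obtain n where "\<bar>x\<bar> < 2 ^ n * (2 * r)" using dyadic_exhaust[of "2 * r" x] r(1) by auto
  then have "\<bar>x / 2 ^ n\<bar> < 2 * r" by (simp add: field_simps)
  from convergent_dyadic_prod_near_0[OF r this]
  have "convergent_prod (\<lambda>j. m (x / 2 ^ Suc (j + n)))" by (simp add: power_add mult_ac)
  then show ?thesis by (rule convergent_prod_offset)
qed

lemma dyadic_prod_refine: "dyadic_prod m x = m (x / 2) * dyadic_prod m (x / 2)"
proof -
  have "dyadic_prod m x = (\<Prod>k<1. m (x / 2 ^ Suc k)) * (\<Prod>k. m (x / 2 ^ Suc (k + 1)))"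
    unfolding dyadic_prod_def
    by (rule has_prod_unique[symmetric,
        OF has_prod_ignore_initial_segment'[OF convergent_dyadic_prod]])
  then show ?thesis by (simp add: dyadic_prod_def mult_ac)
qed

lemma C1_dyadic_prod: "dyadic_prod m C1_differentiable_on UNIV"
proof (rule C1_differentiable_on_open_cover)
  obtain r A where r: "0 < r" "\<And>y. \<bar>y\<bar> < r \<Longrightarrow> 1 / 2 \<le> m y" "\<And>y. \<bar>y\<bar> < r \<Longrightarrow> \<bar>deriv m y\<bar> \<le> A"
    using near_0_bounds by blast
  have "dyadic_prod m C1_differentiable_on {-(2 ^ n * (2 * r))<..<2 ^ n * (2 * r)}" for n
  proof (induction n)
    case 0
    then show ?case using C1_dyadic_prod_near_0[OF r] by simp
  next
    case (Suc n)
    let ?I = "{-(2 ^ Suc n * (2 * r))<..<2 ^ Suc n * (2 * r)}"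
    have half: "(\<lambda>x. x / 2) C1_differentiable_on ?I" by (rule derivative_intros)+ simp
    have "(\<lambda>x. m (x / 2) * dyadic_prod m (x / 2)) C1_differentiable_on ?I"
      by (intro C1_differentiable_on_mult C1_differentiable_on_compose[OF C1_m half]
          C1_differentiable_on_compose[OF Suc half]) auto
    then show ?case by (simp flip: dyadic_prod_refine)
  qed
  moreover fix x
  obtain n where "\<bar>x\<bar> < 2 ^ n * (2 * r)" using dyadic_exhaust[of "2 * r" x] r(1) by auto
  ultimately show "\<exists>T. open T \<and> x \<in> T \<and> dyadic_prod m C1_differentiable_on T"
    by (intro exI[of _ "{-(2 ^ n * (2 * r))<..<2 ^ n * (2 * r)}"]) auto
qed

lemma deriv_dyadic_prod:
  "deriv (dyadic_prod m) x =
    (deriv m (x / 2) * dyadic_prod m (x / 2) + m (x / 2) * deriv (dyadic_prod m) (x / 2)) / 2"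
proof -
  note D = m_has_deriv C1_differentiable_on_has_deriv[OF C1_dyadic_prod UNIV_I]
  have "((\<lambda>x. m (x / 2) * dyadic_prod m (x / 2)) has_real_derivative
      (deriv m (x / 2) * dyadic_prod m (x / 2) + m (x / 2) * deriv (dyadic_prod m) (x / 2)) / 2)
      (at x)"
    by (auto intro!: derivative_eq_intros DERIV_chain2[OF D(1)] DERIV_chain2[OF D(2)]
        simp: field_simps)
  then show ?thesis by (intro DERIV_imp_deriv) (simp flip: dyadic_prod_refine)
qed

end

section \<open>Band-limited scaling functions and their masks\<close>

lemma C1_compact_support_decay:
  fixes f :: "real \<Rightarrow> real"
  assumes f: "f C1_differentiable_on UNIV" and zero: "\<And>x. R \<le> \<bar>x\<bar> \<Longrightarrow> f x = 0"
  obtains K where "C1_quadratic_decay K f"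
proof -
  have cont: "continuous_on {-R..R} f" "continuous_on {-R..R} (deriv f)"
    using f C1_differentiable_imp_continuous_on[OF f]
    by (auto simp: C1_differentiable_on_iff_deriv intro: continuous_on_subset)
  have "bounded (f ` {-R..R} \<union> deriv f ` {-R..R})"
    unfolding bounded_Un by (intro conjI compact_imp_bounded compact_continuous_image cont) simp_all
  then obtain b where "\<forall>y \<in> f ` {-R..R} \<union> deriv f ` {-R..R}. norm y \<le> b"
    unfolding bounded_iff by blast
  then have b: "\<bar>f x\<bar> \<le> b" "\<bar>deriv f x\<bar> \<le> b" if "\<bar>x\<bar> \<le> R" for x
    using that by (auto simp: abs_le_iff)
  have "\<bar>f x\<bar> \<le> \<bar>b\<bar> * (1 + R\<^sup>2) / (1 + x\<^sup>2) \<and> \<bar>deriv f x\<bar> \<le> \<bar>b\<bar> * (1 + R\<^sup>2) / (1 + x\<^sup>2)" for x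
  proof (cases "R \<le> \<bar>x\<bar>")
    case True
    then show ?thesis
      using zero deriv_eq_0_if_const_outside[OF f zero] by (simp add: add_nonneg_nonneg)
  next
    case False
    then have "\<bar>x\<bar>\<^sup>2 \<le> R\<^sup>2" by (intro power_mono) auto
    then have "\<bar>b\<bar> * (1 + x\<^sup>2) \<le> \<bar>b\<bar> * (1 + R\<^sup>2)" by (intro mult_left_mono) auto
    then have "\<bar>b\<bar> \<le> \<bar>b\<bar> * (1 + R\<^sup>2) / (1 + x\<^sup>2)" by (simp add: pos_le_divide_eq add_pos_nonneg)
    then show ?thesis using b[of x] False by auto
  qed
  then show ?thesis using f by (intro that) (auto simp: C1_dominated_def)
qed

locale band_limited =
  fixes H :: "real \<Rightarrow> real"
  assumes C1_H: "H C1_differentiable_on UNIV" and abs_H_le_1: "\<bar>H x\<bar> \<le> 1"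
    and H_eq_1: "\<bar>x\<bar> \<le> 2 * pi / 3 \<Longrightarrow> H x = 1" and H_eq_0: "4 * pi / 3 \<le> \<bar>x\<bar> \<Longrightarrow> H x = 0"
begin

definition scaling_mask :: "real \<Rightarrow> real" where
  "scaling_mask = periodize (\<lambda>x. H (2 * x))"

sublocale periodic_scaling_mask: periodic_fun_simple scaling_mask "2 * pi"
  unfolding scaling_mask_def by (rule periodic_periodize)

lemma deriv_H_eq_0: "4 * pi / 3 \<le> \<bar>x\<bar> \<Longrightarrow> deriv H x = 0"
  by (rule deriv_eq_0_if_const_outside[OF C1_H H_eq_0])

lemma H_decay: obtains K where "C1_quadratic_decay K H"
  using C1_compact_support_decay[OF C1_H H_eq_0] by blast

lemma H_scaled_decay: obtains K where "C1_quadratic_decay K (\<lambda>x. H (2 * x))"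
  using C1_compact_support_decay[OF C1_differentiable_on_scale[OF C1_H], of "2 * pi / 3" 2] H_eq_0
  by auto

lemma H_square_integral_pos: "0 < (LINT x|lborel. (H x)\<^sup>2)"
proof -
  obtain K where K: "C1_quadratic_decay K H" by (rule H_decay)
  have "integrable lborel (\<lambda>x. H x * H x)"
    using C1_quadratic_decay_mult[OF K C1_quadratic_decay_bounded[OF K]]
    by (rule C1_quadratic_decay_integrable)
  then have int: "integrable lborel (\<lambda>x. (H x)\<^sup>2)" by (simp add: power2_eq_square)
  have "(LINT x|lborel. indicator {0..1::real} x) \<le> (LINT x|lborel. (H x)\<^sup>2)"
  proof (rule Bochner_Integration.integral_mono[OF _ int])
    show "indicator {0..1} x \<le> (H x)\<^sup>2" for x
      using H_eq_1[of x] pi_gt3 by (auto simp: indicator_def)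
  qed simp
  then show ?thesis by simp
qed

lemma deriv_scaling_mask: "deriv scaling_mask = periodize (\<lambda>x. 2 * deriv H (2 * x))"
  and C1_bounded_scaling_mask: "\<exists>B\<ge>1. C1_bounded B scaling_mask"
proof -
  obtain K where K: "C1_quadratic_decay K (\<lambda>x. H (2 * x))" by (rule H_scaled_decay)
  show "deriv scaling_mask = periodize (\<lambda>x. 2 * deriv H (2 * x))"
    unfolding scaling_mask_def deriv_periodize[OF K] deriv_scale[OF C1_H] ..
  have "C1_bounded (max 1 (K * int_inverse_square_sum)) scaling_mask"
    unfolding scaling_mask_def by (rule C1_dominated_mono[OF C1_bounded_periodize[OF K]]) simp
  then show "\<exists>B\<ge>1. C1_bounded B scaling_mask" by (intro exI conjI) auto
qed

lemma C1_scaling_mask: "scaling_mask C1_differentiable_on UNIV"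
  using C1_bounded_scaling_mask C1_dominated_C1 by blast

lemma scaling_mask_eq_H:
  assumes "\<bar>x\<bar> \<le> 4 * pi / 3"
  shows "scaling_mask x = H (2 * x)" "deriv scaling_mask x = 2 * deriv H (2 * x)"
  unfolding scaling_mask_def deriv_scaling_mask[unfolded scaling_mask_def]
  by (rule periodize_eq_single[where r = "2 * pi / 3"]; use assms H_eq_0 deriv_H_eq_0 in simp)+

lemma scaling_mask_eq_H_shifted:
  obtains y where "scaling_mask x = H (2 * y)" "deriv scaling_mask x = 2 * deriv H (2 * y)"
    "cos x = cos y" "\<bar>y\<bar> \<le> pi"
proof -
  interpret deriv_scaling_mask: periodic_fun_simple "deriv scaling_mask" "2 * pi"
    by (rule deriv_periodic) unfold_locales
  obtain n :: int where n: "\<bar>x + of_int n * (2 * pi)\<bar> \<le> pi" by (rule int_shift_abs_le_pi)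
  then have "\<bar>x + of_int n * (2 * pi)\<bar> \<le> 4 * pi / 3" using pi_gt_zero by linarith
  from scaling_mask_eq_H[OF this] n show ?thesis
    using cos.plus_of_int[of x n]
    by (intro that) (simp_all add: periodic_scaling_mask.plus_of_int deriv_scaling_mask.plus_of_int)
qed

lemma abs_scaling_mask_le_1: "\<bar>scaling_mask x\<bar> \<le> 1"
  by (metis abs_H_le_1 scaling_mask_eq_H_shifted)

lemma scaling_mask_eq_0:
  assumes "cos x \<le> - 1 / 2"
  shows "scaling_mask x = 0" "deriv scaling_mask x = 0"
proof -
  obtain y where y: "scaling_mask x = H (2 * y)" "deriv scaling_mask x = 2 * deriv H (2 * y)"
    "cos x = cos y" "\<bar>y\<bar> \<le> pi"
    by (rule scaling_mask_eq_H_shifted)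
  have "2 * pi / 3 \<le> \<bar>y\<bar>"
  proof (rule ccontr)
    assume "\<not> 2 * pi / 3 \<le> \<bar>y\<bar>"
    then have "cos (2 * pi / 3) < cos \<bar>y\<bar>" by (intro cos_monotone_0_pi) auto
    then show False using assms y(3) by (simp add: cos_120)
  qed
  then show "scaling_mask x = 0" "deriv scaling_mask x = 0"
    using H_eq_0 deriv_H_eq_0 y(1,2) by simp_all
qed

lemma scaling_mask_eq_1:
  assumes "\<bar>x\<bar> < pi / 3"
  shows "scaling_mask x = 1" "deriv scaling_mask x = 0"
proof -
  have one: "scaling_mask y = 1" if "y \<in> ball 0 (pi / 3)" for y
  proof -
    have "\<bar>y\<bar> < pi / 3" using that by simp
    then have "\<bar>y\<bar> \<le> 4 * pi / 3" "\<bar>2 * y\<bar> \<le> 2 * pi / 3" using pi_gt_zero by linarith+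
    then show ?thesis using scaling_mask_eq_H(1) H_eq_1 by simp
  qed
  have x: "x \<in> ball 0 (pi / 3)" using assms by simp
  show "scaling_mask x = 1" by (rule one[OF x])
  show "deriv scaling_mask x = 0"
    by (rule deriv_eq_0_if_const_on[OF C1_differentiable_on_has_deriv[OF C1_scaling_mask UNIV_I]
          one x])
      (simp_all only: at_within_open[OF x open_ball] at_neq_bot not_False_eq_True)
qed

end

section \<open>Perturbations of a band-limited mask\<close>

lemma abs_exp_minus_one_le:
  fixes s :: real
  assumes "\<bar>s\<bar> \<le> 1 / 2"
  shows "\<bar>exp s - 1\<bar> \<le> 2 * \<bar>s\<bar>"
proof -
  have "exp s \<le> 1 + 2 * \<bar>s\<bar>" using exp_bound_lemma[of s] assms by simp
  then show ?thesis using exp_ge_add_one_self[of s] by linarith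
qed

lemma cos_le_minus_half:
  assumes "2 * pi / 3 \<le> \<bar>x\<bar>" "\<bar>x\<bar> \<le> 4 * pi / 3"
  shows "cos x \<le> - 1 / 2"
proof -
  have "\<bar>\<bar>x\<bar> - pi\<bar> \<le> pi / 3" using assms by linarith
  then have "cos (pi / 3) \<le> cos \<bar>\<bar>x\<bar> - pi\<bar>" by (intro cos_monotone_0_pi_le) auto
  then show ?thesis by (simp add: cos_60 cos_diff)
qed

definition stopband_weight :: "real \<Rightarrow> real" where
  "stopband_weight x = (if cos x \<le> - 1 / 2 then cos (x / 2) ^ 4 else 1)"

text \<open>Off the stopband, doubling multiplies the weight by at least 8: either the fourth power of the
  sine grows that much, or the doubled point lies in the stopband and gains the factor 9. A mask \<open>m\<close>
  close to a band-limited one therefore satisfies everywhere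
  \<open>\<bar>m x\<bar> * refine_weight x \<le> refine_weight (2 * x) / 4\<close>; iterated along the
  refinement equation, the factor 1/4 yields quadratic decay.\<close>

definition refine_weight :: "real \<Rightarrow> real" where
  "refine_weight x = sin (x / 2) ^ 4 * (if cos x \<le> - 1 / 2 then 9 else 1)"

lemma cos_eq_half: "cos x = 2 * (cos (x / 2))\<^sup>2 - 1" "cos x = 1 - 2 * (sin (x / 2))\<^sup>2" for x :: real
  using cos_double_cos[of "x / 2"] cos_double_sin[of "x / 2"] by simp_all

lemma stopband_weight_le_1: "stopband_weight x \<le> 1"
  using power_le_one[of "\<bar>cos (x / 2)\<bar>" 4] by (simp add: stopband_weight_def)

lemma refine_weight_nonneg: "0 \<le> refine_weight x"
  by (simp add: refine_weight_def)

lemma refine_weight_le: "refine_weight x \<le> 9"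
proof -
  have "sin (x / 2) ^ 4 \<le> 1" using power_le_one[of "\<bar>sin (x / 2)\<bar>" 4] by simp
  then show ?thesis by (simp add: refine_weight_def)
qed

lemma refine_weight_ge_5:
  assumes "cos x \<le> - 1 / 2"
  shows "5 \<le> refine_weight x"
proof -
  have "3 / 4 \<le> (sin (x / 2))\<^sup>2" using assms cos_eq_half(2)[of x] by simp
  then have "(3 / 4)\<^sup>2 \<le> ((sin (x / 2))\<^sup>2)\<^sup>2" by (intro power_mono) auto
  then have "9 / 16 \<le> sin (x / 2) ^ 4" by (simp add: power_divide)
  then show ?thesis using assms by (simp add: refine_weight_def)
qed

lemma refine_weight_double:
  "refine_weight (2 * x) =
      16 * (sin (x / 2) ^ 4 * cos (x / 2) ^ 4) * (if \<bar>cos x\<bar> \<le> 1 / 2 then 9 else 1)"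
proof -
  have "sin x = 2 * sin (x / 2) * cos (x / 2)" using sin_double[of "x / 2"] by simp
  moreover have "cos (2 * x) \<le> - 1 / 2 \<longleftrightarrow> \<bar>cos x\<bar> \<le> 1 / 2"
    unfolding cos_double_cos using abs_le_square_iff[of "cos x" "1 / 2"]
    by (auto simp: power_divide)
  ultimately show ?thesis by (simp add: refine_weight_def power_mult_distrib)
qed

lemma refine_weight_double_stopband:
  assumes "cos x \<le> - 1 / 2"
  shows "stopband_weight x * refine_weight x \<le> refine_weight (2 * x)"
proof -
  have "9 * (sin (x / 2) ^ 4 * cos (x / 2) ^ 4) \<le>
      16 * (sin (x / 2) ^ 4 * cos (x / 2) ^ 4) * (if \<bar>cos x\<bar> \<le> 1 / 2 then 9 else 1)"
    by simp
  then show ?thesis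
    using assms unfolding refine_weight_double
    by (simp add: stopband_weight_def refine_weight_def mult_ac)
qed

lemma refine_weight_double_passband:
  assumes "- 1 / 2 < cos x"
  shows "8 * refine_weight x \<le> refine_weight (2 * x)"
proof -
  let ?c = "cos (x / 2) ^ 4" and ?k = "if \<bar>cos x\<bar> \<le> 1 / 2 then 9 else 1 :: real"
  have "1 / 2 \<le> ?c * ?k"
  proof (cases "\<bar>cos x\<bar> \<le> 1 / 2")
    case True
    have "(1 / 4)\<^sup>2 \<le> ((cos (x / 2))\<^sup>2)\<^sup>2"
      using assms cos_eq_half(1)[of x] by (intro power_mono) auto
    then show ?thesis using True by (simp add: power_divide)
  next
    case False
    then have "3 / 4 \<le> (cos (x / 2))\<^sup>2" using assms cos_eq_half(1)[of x] by linarith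
    then have "(3 / 4)\<^sup>2 \<le> ((cos (x / 2))\<^sup>2)\<^sup>2" by (intro power_mono) auto
    then show ?thesis using False by (simp add: power_divide)
  qed
  then have "16 * sin (x / 2) ^ 4 * (1 / 2) \<le> 16 * sin (x / 2) ^ 4 * (?c * ?k)"
    by (rule mult_left_mono) simp
  then show ?thesis
    using assms unfolding refine_weight_double by (simp add: refine_weight_def mult_ac)
qed

lemma dyadic_shell_induct [consumes 2, case_names base step]:
  fixes x :: real
  assumes "0 < a" "a \<le> \<bar>x\<bar>"
    and base: "\<And>x. a \<le> \<bar>x\<bar> \<Longrightarrow> \<bar>x\<bar> < 2 * a \<Longrightarrow> P x"
    and step: "\<And>x. a \<le> \<bar>x / 2\<bar> \<Longrightarrow> P (x / 2) \<Longrightarrow> P x"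
  shows "P x"
proof -
  obtain n where "\<bar>x\<bar> < 2 ^ n * (2 * a)" using dyadic_exhaust[of "2 * a" x] assms(1) by auto
  with assms(2) show ?thesis
  proof (induction n arbitrary: x)
    case (Suc n)
    show ?case
    proof (cases "\<bar>x\<bar> < 2 * a")
      case True
      with Suc.prems show ?thesis by (intro base)
    next
      case False
      with Suc.prems show ?thesis by (intro step[OF _ Suc.IH]) auto
    qed
  qed (simp add: base)
qed

locale perturbed_mask = band_limited H + C1_mask m for H m :: "real \<Rightarrow> real" +
  fixes B E :: real
  assumes B_ge_1: "1 \<le> B" and mask_dominated: "C1_bounded B scaling_mask"
    and mask_close: "C1_dominated (\<lambda>x. E * stopband_weight x) (\<lambda>x. m x - scaling_mask x)"
    and E_le: "E \<le> 1 / 100"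
begin

abbreviation \<phi> :: "real \<Rightarrow> real" where "\<phi> \<equiv> dyadic_prod m"

lemma m_close:
  "\<bar>m x - scaling_mask x\<bar> \<le> E * stopband_weight x"
  "\<bar>deriv m x - deriv scaling_mask x\<bar> \<le> E * stopband_weight x"
  using C1_dominated_abs_le[OF mask_close, of x] C1_dominated_abs_deriv_le[OF mask_close, of x]
    deriv_diff_C1[OF C1_m C1_scaling_mask, of x] by simp_all

lemma E_nonneg: "0 \<le> E"
  using m_close(1)[of 0] by (simp add: stopband_weight_def)

lemma m_close_unweighted:
  "\<bar>m x - scaling_mask x\<bar> \<le> E" "\<bar>deriv m x - deriv scaling_mask x\<bar> \<le> E"
  using m_close[of x] mult_left_mono[OF stopband_weight_le_1 E_nonneg, of x] by simp_all

lemma m_stopband: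
  assumes "cos x \<le> - 1 / 2"
  shows "\<bar>m x\<bar> \<le> E * stopband_weight x" "\<bar>deriv m x\<bar> \<le> E * stopband_weight x"
  using m_close[of x] scaling_mask_eq_0[OF assms] by simp_all

lemma m_bounded: "\<bar>m x\<bar> \<le> 2" "\<bar>deriv m x\<bar> \<le> 2 * B"
  using m_close_unweighted[of x] abs_scaling_mask_le_1[of x]
    C1_dominated_abs_deriv_le[OF mask_dominated, of x] E_le B_ge_1
  by linarith+

lemma phi_near_0:
  assumes "\<bar>x\<bar> < 2 * pi / 3"
  shows "\<bar>\<phi> x - 1\<bar> \<le> 10 * E" "\<bar>deriv \<phi> x\<bar> \<le> 3 * E"
proof -
  have low: "1 / 2 \<le> m y" "\<bar>deriv m y\<bar> \<le> E" if "\<bar>y\<bar> < pi / 3" for y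
    using m_close_unweighted[of y] scaling_mask_eq_1[OF that] E_le by auto
  have r: "0 < pi / 3" and x: "\<bar>x\<bar> < 2 * (pi / 3)" using assms by simp_all
  have "2 * E * \<bar>x\<bar> \<le> 2 * E * (5 / 2)"
    using x pi_approx E_nonneg by (intro mult_left_mono) auto
  then have ln: "\<bar>ln (\<phi> x)\<bar> \<le> 5 * E" using abs_ln_dyadic_prod_le[OF r low x] by simp
  then have "\<bar>exp (ln (\<phi> x)) - 1\<bar> \<le> 2 * (5 * E)"
    using abs_exp_minus_one_le[of "ln (\<phi> x)"] E_le by simp
  then show close: "\<bar>\<phi> x - 1\<bar> \<le> 10 * E" using dyadic_prod_near_0_pos[OF r low x] by simp
  have "2 * E * \<phi> x \<le> 2 * E * (3 / 2)"
    using close E_le E_nonneg by (intro mult_left_mono) auto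
  then show "\<bar>deriv \<phi> x\<bar> \<le> 3 * E" using abs_deriv_dyadic_prod_le[OF r low x] by simp
qed

lemma phi_close_core:
  assumes "\<bar>x\<bar> < 4 * pi / 3"
  shows "\<bar>\<phi> x - H x\<bar> \<le> 12 * E" "\<bar>deriv \<phi> x - deriv H x\<bar> \<le> 9 * B * E"
proof -
  let ?y = "x / 2"
  have y: "\<bar>?y\<bar> < 2 * pi / 3" "\<bar>?y\<bar> \<le> 4 * pi / 3" using assms by auto
  note near = phi_near_0[OF y(1)]
  note H = scaling_mask_eq_H[OF y(2), simplified]
  have \<phi>: "\<bar>\<phi> ?y\<bar> \<le> 11 / 10" using near(1) E_le by linarith
  have BE: "E \<le> B * E" using B_ge_1 E_nonneg by (simp add: mult_le_cancel_right1)
  have "\<phi> x - H x = (m ?y - scaling_mask ?y) * \<phi> ?y + scaling_mask ?y * (\<phi> ?y - 1)"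
    unfolding dyadic_prod_refine[of x] H by (simp add: algebra_simps)
  moreover have "\<bar>(m ?y - scaling_mask ?y) * \<phi> ?y\<bar> \<le> E * (11 / 10)"
    unfolding abs_mult using m_close_unweighted \<phi> E_nonneg by (intro mult_mono) auto
  moreover have "\<bar>scaling_mask ?y * (\<phi> ?y - 1)\<bar> \<le> 1 * (10 * E)"
    unfolding abs_mult using abs_scaling_mask_le_1 near(1) by (intro mult_mono) auto
  ultimately show "\<bar>\<phi> x - H x\<bar> \<le> 12 * E" using E_nonneg by linarith
  have "deriv \<phi> x - deriv H x =
      ((deriv m ?y - deriv scaling_mask ?y) * \<phi> ?y + deriv scaling_mask ?y * (\<phi> ?y - 1) +
        m ?y * deriv \<phi> ?y) / 2"
    unfolding deriv_dyadic_prod[of x] H by (simp add: algebra_simps)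
  moreover have "\<bar>(deriv m ?y - deriv scaling_mask ?y) * \<phi> ?y\<bar> \<le> E * (11 / 10)"
    unfolding abs_mult using m_close_unweighted \<phi> E_nonneg by (intro mult_mono) auto
  moreover have "\<bar>deriv scaling_mask ?y * (\<phi> ?y - 1)\<bar> \<le> B * (10 * E)"
    unfolding abs_mult using C1_dominated_abs_deriv_le[OF mask_dominated] near(1) B_ge_1
    by (intro mult_mono) auto
  moreover have "\<bar>m ?y * deriv \<phi> ?y\<bar> \<le> 2 * (3 * E)"
    unfolding abs_mult using m_bounded near(2) by (intro mult_mono) auto
  ultimately show "\<bar>deriv \<phi> x - deriv H x\<bar> \<le> 9 * B * E" using BE by (simp add: mult.assoc)
qed

lemma m_refine_weight_stopband:
  assumes "cos x \<le> - 1 / 2" and "\<bar>a\<bar> \<le> E * stopband_weight x"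
  shows "\<bar>a\<bar> * refine_weight x \<le> E * refine_weight (2 * x)"
proof -
  have "\<bar>a\<bar> * refine_weight x \<le> E * (stopband_weight x * refine_weight x)"
    using mult_right_mono[OF assms(2) refine_weight_nonneg] by (simp add: mult.assoc)
  also have "\<dots> \<le> E * refine_weight (2 * x)"
    by (intro mult_left_mono refine_weight_double_stopband assms E_nonneg)
  finally show ?thesis .
qed

lemma m_refine_weight:
  "\<bar>m x\<bar> * refine_weight x \<le> refine_weight (2 * x) / 4"
  "\<bar>deriv m x\<bar> * refine_weight x \<le> B * refine_weight (2 * x) / 4"
proof -
  have "\<bar>m x\<bar> * refine_weight x \<le> refine_weight (2 * x) / 4 \<and>
      \<bar>deriv m x\<bar> * refine_weight x \<le> B * refine_weight (2 * x) / 4"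
  proof (cases "cos x \<le> - 1 / 2")
    case True
    have "E * refine_weight (2 * x) \<le> 1 / 4 * refine_weight (2 * x)"
      "1 * refine_weight (2 * x) \<le> B * refine_weight (2 * x)"
      using E_le B_ge_1 refine_weight_nonneg by (intro mult_right_mono; simp)+
    then show ?thesis
      using m_refine_weight_stopband[OF True m_stopband(1)[OF True]]
        m_refine_weight_stopband[OF True m_stopband(2)[OF True]] by simp
  next
    case False
    then have "8 * refine_weight x \<le> refine_weight (2 * x)"
      by (intro refine_weight_double_passband) simp
    moreover have "\<bar>m x\<bar> * refine_weight x \<le> 2 * refine_weight x"
      "\<bar>deriv m x\<bar> * refine_weight x \<le> 2 * B * refine_weight x"
      using m_bounded refine_weight_nonneg by (intro mult_right_mono; simp)+
    moreover have "B * (8 * refine_weight x) \<le> B * refine_weight (2 * x)"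
      using calculation(1) B_ge_1 by (intro mult_left_mono) auto
    ultimately show ?thesis by linarith
  qed
  then show "\<bar>m x\<bar> * refine_weight x \<le> refine_weight (2 * x) / 4"
    "\<bar>deriv m x\<bar> * refine_weight x \<le> B * refine_weight (2 * x) / 4" by auto
qed

lemma phi_le_refine_weight:
  assumes "2 * pi / 3 \<le> \<bar>y\<bar>" "\<bar>y\<bar> < 4 * pi / 3"
  shows "\<bar>\<phi> y\<bar> \<le> refine_weight y" "\<bar>deriv \<phi> y\<bar> \<le> B * refine_weight y"
proof -
  have weight: "5 \<le> refine_weight y"
    using assms by (intro refine_weight_ge_5 cos_le_minus_half) auto
  then have B_weight: "B * 5 \<le> B * refine_weight y" using B_ge_1 by (intro mult_left_mono) auto
  have BE: "B * E \<le> B * (1 / 100)" using B_ge_1 E_le by (intro mult_left_mono) auto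
  have "\<bar>y / 2\<bar> \<le> 4 * pi / 3" using assms by auto
  then have "\<bar>deriv H y\<bar> \<le> B"
    using scaling_mask_eq_H(2)[of "y / 2"] C1_dominated_abs_deriv_le[OF mask_dominated, of "y / 2"]
      B_ge_1 by auto
  then show "\<bar>\<phi> y\<bar> \<le> refine_weight y" "\<bar>deriv \<phi> y\<bar> \<le> B * refine_weight y"
    using phi_close_core(1)[OF assms(2)] phi_close_core(2)[OF assms(2), unfolded mult.assoc]
      abs_H_le_1[of y] weight B_weight E_le BE B_ge_1 by linarith+
qed

lemma phi_shell:
  assumes "4 * pi / 3 \<le> \<bar>x\<bar>" "\<bar>x\<bar> < 2 * (4 * pi / 3)"
  shows "\<bar>\<phi> x\<bar> * x\<^sup>2 \<le> 72 * E * refine_weight x" "\<bar>deriv \<phi> x\<bar> * x\<^sup>2 \<le> 72 * B * E * refine_weight x"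
proof -
  let ?y = "x / 2" and ?w = "refine_weight x"
  have y: "2 * pi / 3 \<le> \<bar>?y\<bar>" "\<bar>?y\<bar> < 4 * pi / 3" using assms by auto
  then have stop: "cos ?y \<le> - 1 / 2" by (intro cos_le_minus_half) auto
  have m: "\<bar>m ?y\<bar> * refine_weight ?y \<le> E * ?w" "\<bar>deriv m ?y\<bar> * refine_weight ?y \<le> E * ?w"
    using m_refine_weight_stopband[OF stop m_stopband(1)[OF stop]]
      m_refine_weight_stopband[OF stop m_stopband(2)[OF stop]] by simp_all
  note \<phi> = phi_le_refine_weight[OF y]
  have "\<bar>m ?y * \<phi> ?y\<bar> \<le> E * ?w" "\<bar>deriv m ?y * \<phi> ?y\<bar> \<le> E * ?w"
    using m mult_left_mono[OF \<phi>(1), of "\<bar>m ?y\<bar>"] mult_left_mono[OF \<phi>(1), of "\<bar>deriv m ?y\<bar>"]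
    by (simp_all add: abs_mult)
  moreover have "\<bar>m ?y * deriv \<phi> ?y\<bar> \<le> B * (E * ?w)"
  proof -
    have "\<bar>m ?y * deriv \<phi> ?y\<bar> \<le> \<bar>m ?y\<bar> * (B * refine_weight ?y)"
      unfolding abs_mult by (rule mult_left_mono[OF \<phi>(2)]) simp
    also have "\<dots> = B * (\<bar>m ?y\<bar> * refine_weight ?y)" by simp
    also have "\<dots> \<le> B * (E * ?w)" by (rule mult_left_mono[OF m(1)]) (use B_ge_1 in simp)
    finally show ?thesis .
  qed
  moreover have "E * ?w \<le> B * (E * ?w)"
    using mult_right_mono[OF B_ge_1 mult_nonneg_nonneg[OF E_nonneg refine_weight_nonneg[of x]]]
    by simp
  ultimately have bound: "\<bar>\<phi> x\<bar> \<le> E * ?w" "\<bar>deriv \<phi> x\<bar> \<le> B * (E * ?w)"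
    unfolding dyadic_prod_refine[of x] deriv_dyadic_prod[of x]
    using abs_triangle_ineq[of "deriv m ?y * \<phi> ?y" "m ?y * deriv \<phi> ?y"] by simp_all
  have "\<bar>x\<bar>\<^sup>2 \<le> (42 / 5)\<^sup>2" using assms pi_approx by (intro power_mono) auto
  then have x2: "x\<^sup>2 \<le> 72" by (simp add: power_divide)
  have "0 \<le> E * ?w" "0 \<le> B * (E * ?w)" using E_nonneg B_ge_1 refine_weight_nonneg by simp_all
  then have "\<bar>\<phi> x\<bar> * x\<^sup>2 \<le> E * ?w * 72" "\<bar>deriv \<phi> x\<bar> * x\<^sup>2 \<le> B * (E * ?w) * 72"
    by (intro mult_mono bound x2; simp)+
  then show "\<bar>\<phi> x\<bar> * x\<^sup>2 \<le> 72 * E * ?w" "\<bar>deriv \<phi> x\<bar> * x\<^sup>2 \<le> 72 * B * E * ?w"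
    by (simp_all add: mult_ac)
qed

lemma phi_tail:
  assumes "4 * pi / 3 \<le> \<bar>x\<bar>"
  shows "\<bar>\<phi> x\<bar> * x\<^sup>2 \<le> 72 * E * refine_weight x"
proof -
  have "0 < 4 * pi / 3" by simp
  then show ?thesis using assms
  proof (induction x rule: dyadic_shell_induct)
    case (step x)
    have "\<bar>\<phi> x\<bar> * x\<^sup>2 = 4 * \<bar>m (x / 2)\<bar> * (\<bar>\<phi> (x / 2)\<bar> * (x / 2)\<^sup>2)"
      unfolding dyadic_prod_refine[of x] by (simp add: abs_mult power_divide)
    also have "\<dots> \<le> 4 * \<bar>m (x / 2)\<bar> * (72 * E * refine_weight (x / 2))"
      by (intro mult_left_mono step.IH) simp
    also have "\<dots> = 288 * E * (\<bar>m (x / 2)\<bar> * refine_weight (x / 2))" by simp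
    also have "\<dots> \<le> 288 * E * (refine_weight (2 * (x / 2)) / 4)"
      by (intro mult_left_mono m_refine_weight) (simp add: E_nonneg)
    finally show ?case by simp
  qed (rule phi_shell)
qed

lemma deriv_phi_tail:
  assumes "4 * pi / 3 \<le> \<bar>x\<bar>"
  shows "\<bar>deriv \<phi> x\<bar> * x\<^sup>2 \<le> 72 * B * E * refine_weight x"
proof -
  have "0 < 4 * pi / 3" by simp
  then show ?thesis using assms
  proof (induction x rule: dyadic_shell_induct)
    case (step x)
    let ?w = "refine_weight (x / 2)"
    have "\<bar>deriv \<phi> x\<bar> * x\<^sup>2 \<le>
        (\<bar>deriv m (x / 2)\<bar> * \<bar>\<phi> (x / 2)\<bar> + \<bar>m (x / 2)\<bar> * \<bar>deriv \<phi> (x / 2)\<bar>) / 2 * x\<^sup>2"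
      unfolding deriv_dyadic_prod[of x] by (intro mult_right_mono) (auto simp: abs_mult[symmetric])
    also have "\<dots> = 2 * \<bar>deriv m (x / 2)\<bar> * (\<bar>\<phi> (x / 2)\<bar> * (x / 2)\<^sup>2) +
        2 * \<bar>m (x / 2)\<bar> * (\<bar>deriv \<phi> (x / 2)\<bar> * (x / 2)\<^sup>2)"
      by (simp add: power_divide field_simps)
    also have "\<dots> \<le> 2 * \<bar>deriv m (x / 2)\<bar> * (72 * E * ?w) + 2 * \<bar>m (x / 2)\<bar> * (72 * B * E * ?w)"
      by (intro add_mono mult_left_mono step.IH phi_tail step.hyps) auto
    also have "\<dots> = 144 * E * (\<bar>deriv m (x / 2)\<bar> * ?w) + 144 * B * E * (\<bar>m (x / 2)\<bar> * ?w)" by simp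
    also have "\<dots> \<le>
        144 * E * (B * refine_weight (2 * (x / 2)) / 4) +
        144 * B * E * (refine_weight (2 * (x / 2)) / 4)"
      using E_nonneg B_ge_1 by (intro add_mono mult_left_mono m_refine_weight) auto
    finally show ?case by (simp add: mult_ac)
  qed (rule phi_shell)
qed

theorem C1_quadratic_decay_phi_diff: "C1_quadratic_decay (1300 * B * E) (\<lambda>x. \<phi> x - H x)"
proof -
  have BE: "E \<le> B * E" "0 \<le> B * E" using B_ge_1 E_nonneg by (auto simp: mult_le_cancel_right1)
  have "\<bar>\<phi> x - H x\<bar> * (1 + x\<^sup>2) \<le> 1300 * B * E \<and> \<bar>deriv \<phi> x - deriv H x\<bar> * (1 + x\<^sup>2) \<le> 1300 * B * E"
    for x
  proof (cases "\<bar>x\<bar> < 4 * pi / 3")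
    case True
    then have "\<bar>x\<bar>\<^sup>2 \<le> 5\<^sup>2" using pi_approx by (intro power_mono) auto
    then have x2: "1 + x\<^sup>2 \<le> 26" by simp
    have "\<bar>\<phi> x - H x\<bar> * (1 + x\<^sup>2) \<le> 12 * E * 26"
      "\<bar>deriv \<phi> x - deriv H x\<bar> * (1 + x\<^sup>2) \<le> 9 * B * E * 26"
      using E_nonneg B_ge_1 by (intro mult_mono phi_close_core[OF True] x2; simp)+
    then show ?thesis using BE by (simp add: mult.assoc)
  next
    case False
    then have tail: "4 * pi / 3 \<le> \<bar>x\<bar>" by simp
    have "72 * E * refine_weight x \<le> 72 * E * 9" "72 * B * E * refine_weight x \<le> 72 * B * E * 9"
      using E_nonneg B_ge_1 by (intro mult_left_mono refine_weight_le; simp)+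
    then have "\<bar>\<phi> x\<bar> * x\<^sup>2 \<le> 648 * (B * E)" "\<bar>deriv \<phi> x\<bar> * x\<^sup>2 \<le> 648 * (B * E)"
      using phi_tail[OF tail] deriv_phi_tail[OF tail] BE by (simp_all add: mult.assoc)
    moreover have "1\<^sup>2 \<le> \<bar>x\<bar>\<^sup>2" using tail pi_approx by (intro power_mono) auto
    then have double: "\<bar>a\<bar> * (1 + x\<^sup>2) \<le> 2 * (\<bar>a\<bar> * x\<^sup>2)" for a
      using mult_left_mono[of "1 + x\<^sup>2" "2 * x\<^sup>2" "\<bar>a\<bar>"] by simp
    ultimately have "\<bar>\<phi> x\<bar> * (1 + x\<^sup>2) \<le> 1300 * (B * E)" "\<bar>deriv \<phi> x\<bar> * (1 + x\<^sup>2) \<le> 1300 * (B * E)"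
      using double[of "\<phi> x"] double[of "deriv \<phi> x"] BE by linarith+
    then show ?thesis using H_eq_0[OF tail] deriv_H_eq_0[OF tail] by (simp add: mult.assoc)
  qed
  then have "\<bar>\<phi> x - H x\<bar> \<le> 1300 * B * E / (1 + x\<^sup>2)"
    "\<bar>deriv \<phi> x - deriv H x\<bar> \<le> 1300 * B * E / (1 + x\<^sup>2)" for x
    by (simp_all add: pos_le_divide_eq add_pos_nonneg)
  then show ?thesis
    unfolding C1_dominated_def deriv_diff_C1[OF C1_dyadic_prod C1_H]
    by (auto intro: C1_differentiable_on_diff C1_dyadic_prod C1_H)
qed

end

section \<open>The Meyer scaling function\<close>

locale meyer =
  fixes \<theta> :: "real \<Rightarrow> real" and \<omega>0 :: real
  assumes theta_odd: "\<theta> (- x) = - \<theta> x" and theta_C2: "C2_real \<theta>"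
    and theta_const: "x > pi / 3 \<Longrightarrow> \<theta> x = pi / 4"
    and omega0: "pi / 3 \<le> \<omega>0" "\<omega>0 < pi / 2"
begin

lemma C1_theta: "\<theta> C1_differentiable_on UNIV"
proof -
  obtain \<theta>' \<theta>'' where "\<And>x. (\<theta> has_real_derivative \<theta>' x) (at x)"
    "\<And>x. (\<theta>' has_real_derivative \<theta>'' x) (at x)"
    using theta_C2 unfolding C2_real_def by blast
  then show ?thesis
    by (intro C1_differentiable_onI continuous_at_imp_continuous_on ballI DERIV_isCont)
qed

lemma theta_ge: "\<theta> x = pi / 4" if "pi / 3 \<le> x"
proof -
  have "closed {x. \<theta> x = pi / 4}"
    by (intro closed_Collect_eq continuous_intros C1_differentiable_imp_continuous_on C1_theta)
  then have "closure {pi / 3<..} \<subseteq> {x. \<theta> x = pi / 4}"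
    using theta_const by (intro closure_minimal) auto
  then show ?thesis using that by auto
qed

lemma theta_le: "\<theta> x = - (pi / 4)" if "x \<le> - (pi / 3)"
  using theta_ge[of "- x"] theta_odd[of x] that by simp

definition slope :: real where "slope = pi / (3 * (pi - 2 * \<omega>0))"

definition edge :: "real \<Rightarrow> real" where "edge y = cos (pi / 4 + \<theta> (slope * (y - pi)))"

lemma slope_pos: "0 < slope" and slope_mult: "slope * (pi - 2 * \<omega>0) = pi / 3"
  using omega0 by (simp_all add: slope_def field_simps)

lemma C1_edge: "edge C1_differentiable_on UNIV"
  unfolding edge_def[abs_def]
  by (intro C1_differentiable_on_compose[OF C1_differentiable_on_cos, of _ _ UNIV]
      C1_differentiable_on_add C1_differentiable_on_compose[OF C1_theta] C1_differentiable_on_mult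
      C1_differentiable_on_diff) simp_all

lemma edge_eq_1: "edge y = 1" if "y \<le> 2 * \<omega>0"
proof -
  have "slope * (y - pi) \<le> slope * - (pi - 2 * \<omega>0)"
    using slope_pos that by (intro mult_left_mono) auto
  then have "slope * (y - pi) \<le> - (pi / 3)" unfolding mult_minus_right slope_mult .
  then show ?thesis by (simp add: edge_def theta_le)
qed

lemma edge_eq_0: "edge y = 0" if "2 * pi - 2 * \<omega>0 \<le> y"
proof -
  have "slope * (pi - 2 * \<omega>0) \<le> slope * (y - pi)"
    using slope_pos that by (intro mult_left_mono) auto
  then show ?thesis unfolding slope_mult by (simp add: edge_def theta_ge)
qed

lemma edge_square_add: "(edge y)\<^sup>2 + (edge (2 * pi - y))\<^sup>2 = 1"
proof -
  have "slope * (2 * pi - y - pi) = - (slope * (y - pi))" by (simp add: algebra_simps)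
  then have "edge (2 * pi - y) = cos (pi / 4 - \<theta> (slope * (y - pi)))"
    by (simp add: edge_def theta_odd)
  also have "\<dots> = sin (pi / 4 + \<theta> (slope * (y - pi)))"
    by (simp add: cos_diff sin_add sin_45 cos_45)
  finally show ?thesis by (simp add: edge_def)
qed

lemma meyer_hat_eq_edge: "meyer_hat \<theta> \<omega>0 x = edge \<bar>x\<bar>"
  using edge_eq_1[of "\<bar>x\<bar>"] edge_eq_0[of "\<bar>x\<bar>"] by (auto simp: meyer_hat_def edge_def slope_def)

sublocale band_limited "meyer_hat \<theta> \<omega>0"
proof
  have "meyer_hat \<theta> \<omega>0 = (\<lambda>x. edge x * edge (- x))"
  proof
    fix x
    have "edge (- \<bar>x\<bar>) = 1" using omega0 pi_gt_zero by (intro edge_eq_1) linarith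
    then have "edge \<bar>x\<bar> = edge \<bar>x\<bar> * edge (- \<bar>x\<bar>)" by simp
    then show "meyer_hat \<theta> \<omega>0 x = edge x * edge (- x)"
      unfolding meyer_hat_eq_edge by (cases "0 \<le> x") auto
  qed
  moreover have "(\<lambda>x. edge x * edge (- x)) C1_differentiable_on UNIV"
    using C1_differentiable_on_scale[OF C1_edge, of "-1"]
    by (intro C1_differentiable_on_mult C1_edge) simp
  ultimately show "meyer_hat \<theta> \<omega>0 C1_differentiable_on UNIV" by simp
  show "\<bar>meyer_hat \<theta> \<omega>0 x\<bar> \<le> 1" for x by (simp add: meyer_hat_eq_edge edge_def)
  show "meyer_hat \<theta> \<omega>0 x = 1" if "\<bar>x\<bar> \<le> 2 * pi / 3" for x
    unfolding meyer_hat_eq_edge by (rule edge_eq_1) (use that omega0 in linarith)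
  show "meyer_hat \<theta> \<omega>0 x = 0" if "4 * pi / 3 \<le> \<bar>x\<bar>" for x
    unfolding meyer_hat_eq_edge by (rule edge_eq_0) (use that omega0 in linarith)
qed

lemma meyer_hat_orthogonal: "periodize (\<lambda>x. (meyer_hat \<theta> \<omega>0 x)\<^sup>2) x = 1"
proof -
  let ?H = "meyer_hat \<theta> \<omega>0"
  interpret H: periodic_fun_simple "periodize (\<lambda>x. (?H x)\<^sup>2)" "2 * pi" by (rule periodic_periodize)
  define y where "y = x - of_int \<lfloor>x / (2 * pi)\<rfloor> * (2 * pi)"
  have y: "0 \<le> y" "y < 2 * pi"
    using floor_divide_lower[of "2 * pi" x] floor_divide_upper[of "2 * pi" x]
    by (simp_all add: y_def algebra_simps)
  have "periodize (\<lambda>x. (?H x)\<^sup>2) x = periodize (\<lambda>x. (?H x)\<^sup>2) y"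
    unfolding y_def by (rule H.minus_of_int[symmetric])
  also have "\<dots> = (\<Sum>\<^sub>\<infinity>k\<in>{0, -1}. (?H (y + of_int k * (2 * pi)))\<^sup>2)"
    unfolding periodize_def
  proof (rule infsum_cong_neutral)
    fix k :: int assume "k \<in> UNIV - {0, - 1}"
    then consider "1 \<le> k" | "k \<le> - 2" by force
    then have "4 * pi / 3 \<le> \<bar>y + of_int k * (2 * pi)\<bar>"
    proof cases
      case 1
      then have "1 * (2 * pi) \<le> of_int k * (2 * pi)" by (intro mult_right_mono) auto
      then show ?thesis using y pi_gt_zero by linarith
    next
      case 2
      then have "of_int k * (2 * pi) \<le> (- 2) * (2 * pi)" by (intro mult_right_mono) auto
      then show ?thesis using y pi_gt_zero by linarith
    qed
    then show "(?H (y + of_int k * (2 * pi)))\<^sup>2 = 0" by (simp add: H_eq_0)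
  qed auto
  also have "\<dots> = (edge y)\<^sup>2 + (edge (2 * pi - y))\<^sup>2"
    using y by (simp add: meyer_hat_eq_edge)
  also have "\<dots> = 1" by (rule edge_square_add)
  finally show ?thesis .
qed

lemma meyer_mask_eq: "meyer_mask \<theta> \<omega>0 = scaling_mask"
proof
  fix x
  define n where "n = \<lfloor>(x + pi) / (2 * pi)\<rfloor>"
  have "\<bar>x - of_int n * (2 * pi)\<bar> \<le> pi"
    using floor_divide_lower[of "2 * pi" "x + pi"] floor_divide_upper[of "2 * pi" "x + pi"]
    by (simp add: n_def abs_le_iff algebra_simps)
  then have "\<bar>x - of_int n * (2 * pi)\<bar> \<le> 4 * pi / 3" using pi_gt_zero by linarith
  then have "scaling_mask x = meyer_hat \<theta> \<omega>0 (2 * (x - of_int n * (2 * pi)))"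
    using scaling_mask_eq_H(1) periodic_scaling_mask.minus_of_int[of x n] by metis
  then show "meyer_mask \<theta> \<omega>0 x = scaling_mask x"
    by (simp add: meyer_mask_def n_def mult.commute)
qed

end

section \<open>Masks with a high-order zero\<close>

lemma C1_dominated_cos_power_mult:
  assumes f: "f C1_differentiable_on UNIV" and bound: "\<And>x. \<bar>f x\<bar> \<le> \<alpha>" "\<And>x. \<bar>deriv f x\<bar> \<le> \<gamma>"
    and l: "3 \<le> l"
  shows "C1_dominated (\<lambda>x. (real l * \<alpha> + \<gamma>) * cos (x / 2) ^ 4) (\<lambda>x. cos (x / 2) ^ (2 * l) * f x)"
proof (rule C1_dominatedI)
  let ?p' = "\<lambda>x. real l * cos (x / 2) ^ (2 * l - 1) * - sin (x / 2)"
  have power_le: "\<bar>cos x ^ k\<bar> \<le> cos x ^ 4" if "4 \<le> k" for k and x :: real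
    using power_decreasing[OF that, of "\<bar>cos x\<bar>"] by (simp add: power_abs)
  have D: "(f has_real_derivative deriv f x) (at x)" for x
    by (rule C1_differentiable_on_has_deriv[OF f]) simp
  show "((\<lambda>x. cos (x / 2) ^ (2 * l) * f x) has_real_derivative
      ?p' x * f x + cos (x / 2) ^ (2 * l) * deriv f x) (at x)" for x
    by (auto intro!: derivative_eq_intros D)
  show "continuous_on UNIV (\<lambda>x. ?p' x * f x + cos (x / 2) ^ (2 * l) * deriv f x)"
    using f C1_differentiable_imp_continuous_on[OF f]
    by (auto simp: C1_differentiable_on_iff_deriv intro!: continuous_intros)
  fix x :: real
  have "0 \<le> \<alpha>" "0 \<le> \<gamma>"
    using order_trans[OF abs_ge_zero bound(1)] order_trans[OF abs_ge_zero bound(2)] by auto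
  have p: "\<bar>cos (x / 2) ^ (2 * l)\<bar> \<le> cos (x / 2) ^ 4" using l by (intro power_le) simp
  have "\<bar>?p' x\<bar> \<le> real l * cos (x / 2) ^ 4 * 1"
    unfolding abs_mult using l by (intro mult_mono power_le) auto
  then have "\<bar>?p' x * f x\<bar> \<le> real l * cos (x / 2) ^ 4 * \<alpha>"
    unfolding abs_mult[of "?p' x"] using bound(1) by (intro mult_mono) auto
  moreover have "\<bar>cos (x / 2) ^ (2 * l) * deriv f x\<bar> \<le> cos (x / 2) ^ 4 * \<gamma>"
    unfolding abs_mult using p bound(2) by (intro mult_mono) auto
  ultimately show
    "\<bar>?p' x * f x + cos (x / 2) ^ (2 * l) * deriv f x\<bar> \<le> (real l * \<alpha> + \<gamma>) * cos (x / 2) ^ 4"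
    using abs_triangle_ineq[of "?p' x * f x" "cos (x / 2) ^ (2 * l) * deriv f x"]
    by (simp add: algebra_simps)
  have "1 * \<alpha> \<le> real l * \<alpha>" using l \<open>0 \<le> \<alpha>\<close> by (intro mult_right_mono) auto
  then have "cos (x / 2) ^ 4 * \<alpha> \<le> cos (x / 2) ^ 4 * (real l * \<alpha> + \<gamma>)"
    using \<open>0 \<le> \<gamma>\<close> by (intro mult_left_mono) auto
  moreover have "\<bar>cos (x / 2) ^ (2 * l) * f x\<bar> \<le> cos (x / 2) ^ 4 * \<alpha>"
    unfolding abs_mult using p bound(1) by (intro mult_mono) auto
  ultimately show "\<bar>cos (x / 2) ^ (2 * l) * f x\<bar> \<le> (real l * \<alpha> + \<gamma>) * cos (x / 2) ^ 4"
    by (simp add: mult.commute)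
qed

lemma inverse_near_1:
  fixes u \<alpha> :: real
  assumes "\<bar>u - 1\<bar> \<le> \<alpha>" "\<alpha> \<le> 1 / 2"
  shows "\<bar>1 / u\<bar> \<le> 2" "\<bar>1 / u - 1\<bar> \<le> 2 * \<alpha>"
proof -
  have u: "1 / 2 \<le> u" using assms by linarith
  then have "1 / u \<le> 1 / (1 / 2)" by (intro divide_left_mono) auto
  then show "\<bar>1 / u\<bar> \<le> 2" using u by simp
  have "1 / u - 1 = (1 - u) / u" using u by (simp add: field_simps)
  moreover have "\<bar>1 - u\<bar> / u \<le> \<alpha> / (1 / 2)" using assms u by (intro frac_le) auto
  ultimately show "\<bar>1 / u - 1\<bar> \<le> 2 * \<alpha>" using u by (simp add: abs_divide)
qed

lemma stopband_weight_bound: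
  assumes "a \<le> 2 * \<mu>" "b \<le> 2" "0 \<le> b" "0 \<le> \<mu>" "1 \<le> B"
  shows "a * (if cos x \<le> - 1 / 2 then 0 else B) + b * (\<mu> * cos (x / 2) ^ 4) \<le>
      4 * B * \<mu> * stopband_weight x"
proof -
  let ?w = "stopband_weight x"
  have w: "0 \<le> ?w" "cos (x / 2) ^ 4 \<le> ?w"
    using power_le_one[of "\<bar>cos (x / 2)\<bar>" 4] by (auto simp: stopband_weight_def)
  have "a * (if cos x \<le> - 1 / 2 then 0 else B) \<le> 2 * (B * (\<mu> * ?w))"
  proof (cases "cos x \<le> - 1 / 2")
    case False
    have "a * B \<le> 2 * \<mu> * B" using assms by (intro mult_right_mono) auto
    then show ?thesis using False by (simp add: stopband_weight_def mult_ac)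
  qed (use assms w(1) in simp)
  moreover have "b * (\<mu> * cos (x / 2) ^ 4) \<le> 2 * (\<mu> * ?w)"
    using assms w by (intro mult_mono) auto
  moreover have "\<mu> * ?w \<le> B * (\<mu> * ?w)"
    using mult_right_mono[OF assms(5), of "\<mu> * ?w"] assms(4) w(1) by simp
  moreover have "4 * B * \<mu> * ?w = 4 * (B * (\<mu> * ?w))" by simp
  ultimately show ?thesis by linarith
qed

context band_limited
begin

definition mask_quotient :: "nat \<Rightarrow> real \<Rightarrow> real" where
  "mask_quotient l x = scaling_mask x / cos (x / 2) ^ (2 * l)"

lemma mask_quotient_0: "mask_quotient l 0 = 1"
  using scaling_mask_eq_1(1)[of 0] by (simp add: mask_quotient_def)

lemma cos_power_mult_mask_quotient: "cos (x / 2) ^ (2 * l) * mask_quotient l x = scaling_mask x"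
proof (cases "cos (x / 2) = 0")
  case True
  then have "cos x \<le> - 1 / 2" using cos_eq_half(1)[of x] by simp
  then show ?thesis by (simp add: mask_quotient_def scaling_mask_eq_0)
qed (simp add: mask_quotient_def)

lemma C1_mask_quotient: "mask_quotient l C1_differentiable_on UNIV"
proof (rule C1_differentiable_on_open_cover)
  fix x
  let ?stop = "{x. cos x < - 1 / 2} :: real set" and ?pass = "{x. - 1 < cos x} :: real set"
  have "(\<lambda>x. x / 2) C1_differentiable_on ?pass" by (rule derivative_intros)+ simp
  then have "(\<lambda>x. cos (x / 2)) C1_differentiable_on ?pass"
    by (rule C1_differentiable_on_compose[OF C1_differentiable_on_cos _ subset_UNIV])
  moreover have "cos (x / 2) \<noteq> 0" if "x \<in> ?pass" for x
    using that cos_eq_half(1)[of x] by auto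
  ultimately have "(\<lambda>x. scaling_mask x / cos (x / 2) ^ (2 * l)) C1_differentiable_on ?pass"
    by (intro C1_differentiable_on_divide C1_differentiable_on_power
        C1_differentiable_on_subset[OF C1_scaling_mask]) auto
  then have pass: "mask_quotient l C1_differentiable_on ?pass"
    by (simp add: mask_quotient_def[abs_def])
  have open_stop: "open ?stop" by (intro open_Collect_less continuous_intros)
  have stop: "mask_quotient l C1_differentiable_on ?stop"
    by (rule C1_differentiable_on_cong[OF open_stop C1_differentiable_on_const[of 0]])
      (simp add: mask_quotient_def scaling_mask_eq_0)
  have "open ?pass" by (intro open_Collect_less continuous_intros)
  moreover have "x \<in> ?pass \<or> x \<in> ?stop" by auto
  ultimately show "\<exists>T. open T \<and> x \<in> T \<and> mask_quotient l C1_differentiable_on T"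
    using open_stop pass stop by blast
qed

lemma periodic_mask_quotient: "periodic_fun_simple (mask_quotient l) (2 * pi)"
proof
  have "cos ((x + 2 * pi) / 2) = - cos (x / 2)" for x :: real
    by (simp add: add_divide_distrib)
  then show "mask_quotient l (x + 2 * pi) = mask_quotient l x" for x
    by (simp add: mask_quotient_def periodic_scaling_mask.plus_period)
qed

lemma C1_dominated_approx_mask_diff:
  assumes U: "U C1_differentiable_on UNIV"
    and approx: "\<And>x. \<bar>U x - mask_quotient l x\<bar> \<le> \<alpha>"
      "\<And>x. \<bar>deriv U x - deriv (mask_quotient l) x\<bar> \<le> \<gamma>"
    and \<alpha>: "\<alpha> \<le> 1 / 2" and l: "3 \<le> l" and B: "1 \<le> B" "C1_bounded B scaling_mask"
  shows "C1_dominated (\<lambda>x. 4 * B * (real l * \<alpha> + \<gamma>) * stopband_weight x)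
    (\<lambda>x. cos (x / 2) ^ (2 * l) * U x / U 0 - scaling_mask x)"
proof -
  let ?q = "mask_quotient l" and ?\<delta> = "1 / U 0" and ?\<mu> = "real l * \<alpha> + \<gamma>"
  let ?v = "\<lambda>x. if cos x \<le> - 1 / 2 then 0 else B"
  have nonneg: "0 \<le> \<alpha>" "0 \<le> \<gamma>"
    using order_trans[OF abs_ge_zero approx(1)] order_trans[OF abs_ge_zero approx(2)] by auto
  have "1 * \<alpha> \<le> real l * \<alpha>" using l nonneg by (intro mult_right_mono) auto
  then have \<mu>: "\<alpha> \<le> ?\<mu>" "0 \<le> ?\<mu>" using nonneg by auto
  have "\<bar>U 0 - 1\<bar> \<le> \<alpha>" using approx(1)[of 0] by (simp add: mask_quotient_0)
  note \<delta> = inverse_near_1[OF this \<alpha>]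
  have "C1_dominated (\<lambda>x. ?\<mu> * cos (x / 2) ^ 4) (\<lambda>x. cos (x / 2) ^ (2 * l) * (U x - ?q x))"
    by (rule C1_dominated_cos_power_mult[OF _ approx(1) _ l])
      (simp_all add: deriv_diff_C1 approx U C1_mask_quotient)
  moreover have "C1_dominated ?v scaling_mask"
    using C1_dominated_C1[OF B(2)] C1_dominated_abs_le[OF B(2)] C1_dominated_abs_deriv_le[OF B(2)]
    by (auto simp: C1_dominated_def scaling_mask_eq_0)
  ultimately have "C1_dominated (\<lambda>x. \<bar>?\<delta> - 1\<bar> * ?v x + \<bar>?\<delta>\<bar> * (?\<mu> * cos (x / 2) ^ 4))
      (\<lambda>x. (?\<delta> - 1) * scaling_mask x + ?\<delta> * (cos (x / 2) ^ (2 * l) * (U x - ?q x)))"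
    by (intro C1_dominated_add C1_dominated_cmult)
  moreover have "(?\<delta> - 1) * scaling_mask x + ?\<delta> * (cos (x / 2) ^ (2 * l) * (U x - ?q x)) =
      cos (x / 2) ^ (2 * l) * U x / U 0 - scaling_mask x" for x
    using cos_power_mult_mask_quotient[of x l] by (simp add: algebra_simps diff_divide_distrib)
  moreover have "\<bar>?\<delta> - 1\<bar> * ?v x + \<bar>?\<delta>\<bar> * (?\<mu> * cos (x / 2) ^ 4) \<le> 4 * B * ?\<mu> * stopband_weight x"
    for x
    using \<delta> \<mu> B(1) by (intro stopband_weight_bound) auto
  ultimately show ?thesis using C1_dominated_mono by simp
qed

theorem C1_quadratic_decay_dyadic_prod_diff:
  assumes U: "U C1_differentiable_on UNIV"
    and approx: "\<And>x. \<bar>U x - mask_quotient l x\<bar> \<le> \<alpha>"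
      "\<And>x. \<bar>deriv U x - deriv (mask_quotient l) x\<bar> \<le> \<gamma>"
    and "\<alpha> \<le> 1 / 2" and l: "3 \<le> l" and B: "1 \<le> B" "C1_bounded B scaling_mask"
    and small: "4 * B * (real l * \<alpha> + \<gamma>) \<le> 1 / 100"
  shows "C1_quadratic_decay (5200 * B\<^sup>2 * (real l * \<alpha> + \<gamma>))
    (\<lambda>x. dyadic_prod (\<lambda>x. cos (x / 2) ^ (2 * l) * U x / U 0) x - H x)"
proof -
  let ?m = "\<lambda>x. cos (x / 2) ^ (2 * l) * U x / U 0"
  note close = C1_dominated_approx_mask_diff[OF assms(1-7)]
  have U0: "U 0 \<noteq> 0" using approx(1)[of 0] assms(4) by (auto simp: mask_quotient_0)
  interpret perturbed_mask H ?m B "4 * B * (real l * \<alpha> + \<gamma>)"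
  proof
    show "?m C1_differentiable_on UNIV"
      using C1_differentiable_on_add[OF C1_dominated_C1[OF close] C1_scaling_mask] by simp
  qed (use B small close U0 in simp_all)
  show ?thesis using C1_quadratic_decay_phi_diff by (simp add: power2_eq_square mult_ac)
qed

end

section \<open>Summation methods applied to the mask quotient\<close>

lemma periodic_summ_method: "periodic_fun_simple (summ_method lam n f) (2 * pi)"
proof
  have "cos (real k * (x + 2 * pi)) = cos (real k * x)"
    "sin (real k * (x + 2 * pi)) = sin (real k * x)" for k x
    using cos.plus_of_nat[of "real k * x" k] sin.plus_of_nat[of "real k * x" k]
    by (simp_all add: distrib_left)
  then show "summ_method lam n f (x + 2 * pi) = summ_method lam n f x" for x
    by (simp add: summ_method_def)
qed

lemma integral_deriv_mult_eq:
  fixes f g :: "real \<Rightarrow> real"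
  assumes f: "f C1_differentiable_on {a..b}" and g: "g C1_differentiable_on {a..b}"
    and ends: "f b * g b = f a * g a" and "a \<le> b"
  shows "integral {a..b} (\<lambda>t. deriv f t * g t) = - integral {a..b} (\<lambda>t. f t * deriv g t)"
proof -
  have D: "((\<lambda>t. f t * g t) has_real_derivative
      deriv f t * g t + f t * deriv g t) (at t within {a..b})" if "t \<in> {a..b}" for t
    using DERIV_mult[OF C1_differentiable_on_has_deriv[OF f that]
        C1_differentiable_on_has_deriv[OF g that]]
    by (simp add: mult.commute has_field_derivative_at_within)
  have int: "(\<lambda>t. deriv f t * g t) integrable_on {a..b}"
    "(\<lambda>t. f t * deriv g t) integrable_on {a..b}"
    using f g C1_differentiable_imp_continuous_on[OF f] C1_differentiable_imp_continuous_on[OF g]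
    by (auto simp: C1_differentiable_on_iff_deriv
        intro!: integrable_continuous_real continuous_intros)
  have "((\<lambda>t. deriv f t * g t + f t * deriv g t) has_integral f b * g b - f a * g a) {a..b}"
    using D \<open>a \<le> b\<close>
    by (intro fundamental_theorem_of_calculus)
      (auto simp: has_real_derivative_iff_has_vector_derivative)
  with has_integral_add[OF int[THEN integrable_integral]]
  have "integral {a..b} (\<lambda>t. deriv f t * g t) + integral {a..b} (\<lambda>t. f t * deriv g t) =
      f b * g b - f a * g a"
    by (rule has_integral_unique)
  then show ?thesis using ends by simp
qed

lemma four_coefficients_deriv:
  assumes f: "f C1_differentiable_on {-pi..pi}" and ends: "f (- pi) = f pi"
  shows "four_a (deriv f) k = real k * four_b f k" "four_b (deriv f) k = - real k * four_a f k"
proof -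
  have D: "((\<lambda>t. cos (real k * t)) has_real_derivative - (real k * sin (real k * t))) (at t)"
    "((\<lambda>t. sin (real k * t)) has_real_derivative real k * cos (real k * t)) (at t)" for t
    by (auto intro!: derivative_eq_intros)
  then have "(\<lambda>t. cos (real k * t)) C1_differentiable_on {-pi..pi}"
    "(\<lambda>t. sin (real k * t)) C1_differentiable_on {-pi..pi}"
    by (auto intro!: C1_differentiable_onI continuous_intros)
  from this[THEN integral_deriv_mult_eq[OF f]]
  show "four_a (deriv f) k = real k * four_b f k" "four_b (deriv f) k = - real k * four_a f k"
    using ends
    by (simp_all add: four_a_def four_b_def D[THEN DERIV_imp_deriv]
        mult.left_commute[of _ "real k"])
qed

lemma continuous_on_summ_method: "continuous_on A (summ_method lam n f)"
  unfolding summ_method_def[abs_def] by (intro continuous_intros)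

lemma summ_method_has_deriv:
  assumes f: "f C1_differentiable_on {-pi..pi}" and ends: "f (- pi) = f pi"
  shows "(summ_method lam n f has_real_derivative summ_method lam n (deriv f) x) (at x)"
proof -
  let ?sum' = "\<Sum>k=1..n. lam n k *
    (four_a f k * (- sin (real k * x) * real k) + four_b f k * (cos (real k * x) * real k))"
  have "((\<lambda>x. four_a f 0 / 2 + (\<Sum>k=1..n. lam n k *
      (four_a f k * cos (real k * x) + four_b f k * sin (real k * x)))) has_real_derivative
      0 + ?sum') (at x)"
    by (intro DERIV_add DERIV_const DERIV_sum DERIV_cmult DERIV_chain2[OF DERIV_cos]
        DERIV_chain2[OF DERIV_sin] DERIV_cmult_Id)
  also have "0 + ?sum' = summ_method lam n (deriv f) x"
    unfolding summ_method_def four_coefficients_deriv[OF f ends] by (simp add: algebra_simps)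
  finally show ?thesis unfolding summ_method_def[abs_def] .
qed

lemma abs_le_Cnorm:
  assumes "continuous_on UNIV f" and "periodic_fun_simple f (2 * pi)"
  shows "\<bar>f x\<bar> \<le> Cnorm f"
proof -
  interpret periodic_fun_simple f "2 * pi" by fact
  obtain n where n: "\<bar>x + of_int n * (2 * pi)\<bar> \<le> pi" by (rule int_shift_abs_le_pi)
  have "compact ((\<lambda>x. \<bar>f x\<bar>) ` {-pi..pi})"
    using assms(1)
    by (intro compact_continuous_image continuous_intros) (auto intro: continuous_on_subset)
  then have "bdd_above ((\<lambda>x. \<bar>f x\<bar>) ` {-pi..pi})"
    by (intro bounded_imp_bdd_above compact_imp_bounded)
  then have "\<bar>f (x + of_int n * (2 * pi))\<bar> \<le> Cnorm f"
    unfolding Cnorm_def using n by (intro cSUP_upper) (auto simp: abs_le_iff)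
  then show ?thesis by (simp only: plus_of_int)
qed

context meyer
begin

abbreviation "H \<equiv> meyer_hat \<theta> \<omega>0"

lemma meyer_mask_l_eq: "meyer_mask_l \<theta> \<omega>0 l = mask_quotient l"
  by (simp add: fun_eq_iff meyer_mask_l_def mask_quotient_def meyer_mask_eq)

context
  fixes lam :: "nat \<Rightarrow> nat \<Rightarrow> real" and nn :: "nat \<Rightarrow> nat" and l :: nat
begin

lemma u_l_has_deriv: "(u_l \<theta> \<omega>0 lam nn l has_real_derivative u1_l \<theta> \<omega>0 lam nn l x) (at x)"
proof -
  have "mask_quotient l (- pi) = mask_quotient l pi"
    by (simp add: mask_quotient_def scaling_mask_eq_0)
  from summ_method_has_deriv[OF C1_differentiable_on_subset[OF C1_mask_quotient subset_UNIV] this]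
  show ?thesis
    unfolding u_l_def u1_l_def meyer_mask_l_eq .
qed

lemma C1_u_l: "u_l \<theta> \<omega>0 lam nn l C1_differentiable_on UNIV"
  using u_l_has_deriv by (rule C1_differentiable_onI) (simp add: u1_l_def continuous_on_summ_method)

lemma u_l_close:
  "\<bar>u_l \<theta> \<omega>0 lam nn l x - mask_quotient l x\<bar> \<le> alpha_l \<theta> \<omega>0 lam nn l"
  "\<bar>deriv (u_l \<theta> \<omega>0 lam nn l) x - deriv (mask_quotient l) x\<bar> \<le> gamma_l \<theta> \<omega>0 lam nn l"
proof -
  have periodic_diff: "periodic_fun_simple (\<lambda>x. f x - g x) (2 * pi)"
    if "periodic_fun_simple f (2 * pi)" "periodic_fun_simple g (2 * pi)" for f g :: "real \<Rightarrow> real"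
    using that by (simp add: periodic_fun_simple_def)
  have cont: "continuous_on UNIV (mask_quotient l)" "continuous_on UNIV (deriv (mask_quotient l))"
    using C1_mask_quotient[of l] C1_differentiable_imp_continuous_on[OF C1_mask_quotient]
    by (auto simp: C1_differentiable_on_iff_deriv)
  show "\<bar>u_l \<theta> \<omega>0 lam nn l x - mask_quotient l x\<bar> \<le> alpha_l \<theta> \<omega>0 lam nn l"
    unfolding alpha_l_def u_l_def meyer_mask_l_eq
    by (intro abs_le_Cnorm periodic_diff periodic_summ_method periodic_mask_quotient
        continuous_intros continuous_on_summ_method cont)
  have "deriv (u_l \<theta> \<omega>0 lam nn l) x = u1_l \<theta> \<omega>0 lam nn l x"
    using u_l_has_deriv by (rule DERIV_imp_deriv)
  moreover have "\<bar>u1_l \<theta> \<omega>0 lam nn l x - deriv (mask_quotient l) x\<bar> \<le> gamma_l \<theta> \<omega>0 lam nn l"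
    unfolding gamma_l_def u1_l_def meyer_mask_l_eq
    by (intro abs_le_Cnorm periodic_diff periodic_summ_method deriv_periodic periodic_mask_quotient
        continuous_intros continuous_on_summ_method cont)
  ultimately show
    "\<bar>deriv (u_l \<theta> \<omega>0 lam nn l) x - deriv (mask_quotient l) x\<bar> \<le> gamma_l \<theta> \<omega>0 lam nn l"
    by simp
qed

lemma phi_hat_l_eq:
  "phi_hat_l \<theta> \<omega>0 lam nn l =
    dyadic_prod (\<lambda>x. cos (x / 2) ^ (2 * l) * u_l \<theta> \<omega>0 lam nn l x / u_l \<theta> \<omega>0 lam nn l 0)"
  by (simp add: fun_eq_iff phi_hat_l_def dyadic_prod_def mask_l_def)

lemma phi_orth_l_eq:
  "phi_orth_l \<theta> \<omega>0 lam nn l =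
      inv_fourier (\<lambda>x. complex_of_real (orthogonalize (phi_hat_l \<theta> \<omega>0 lam nn l) x))"
  by (simp add: phi_orth_l_def phi_orth_hat_l_def Phi_l_def orthogonalize_def periodize_def
      mult.commute)

lemma alpha_l_le_mu_l:
  assumes "1 \<le> l"
  shows "alpha_l \<theta> \<omega>0 lam nn l \<le> mu_l \<theta> \<omega>0 lam nn l" "0 \<le> mu_l \<theta> \<omega>0 lam nn l"
proof -
  have nonneg: "0 \<le> alpha_l \<theta> \<omega>0 lam nn l" "0 \<le> gamma_l \<theta> \<omega>0 lam nn l"
    using u_l_close[of 0] by linarith+
  have "1 * alpha_l \<theta> \<omega>0 lam nn l \<le> real l * alpha_l \<theta> \<omega>0 lam nn l"
    using assms nonneg(1) by (intro mult_right_mono) auto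
  then show "alpha_l \<theta> \<omega>0 lam nn l \<le> mu_l \<theta> \<omega>0 lam nn l" "0 \<le> mu_l \<theta> \<omega>0 lam nn l"
    using nonneg by (auto simp: mu_l_def)
qed

end

lemma phi_hat_l_close:
  obtains \<epsilon> C where "0 < \<epsilon>" "0 \<le> C"
    "\<And>lam nn l. \<lbrakk>3 \<le> l; mu_l \<theta> \<omega>0 lam nn l \<le> \<epsilon>\<rbrakk> \<Longrightarrow>
      C1_quadratic_decay (C * mu_l \<theta> \<omega>0 lam nn l) (\<lambda>x. phi_hat_l \<theta> \<omega>0 lam nn l x - H x)"
proof -
  obtain B where B: "1 \<le> B" "C1_bounded B scaling_mask" using C1_bounded_scaling_mask by blast
  show ?thesis
  proof (rule that[of "1 / (400 * B)" "5200 * B\<^sup>2"])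
    fix lam nn and l :: nat assume l: "3 \<le> l" and \<mu>: "mu_l \<theta> \<omega>0 lam nn l \<le> 1 / (400 * B)"
    have "1 / (400 * B) \<le> 1 / 2" using B(1) by (intro divide_left_mono) auto
    then have "alpha_l \<theta> \<omega>0 lam nn l \<le> 1 / 2"
      using alpha_l_le_mu_l(1)[of l lam nn] l \<mu> by linarith
    moreover have "4 * B * (real l * alpha_l \<theta> \<omega>0 lam nn l + gamma_l \<theta> \<omega>0 lam nn l) \<le> 1 / 100"
      using \<mu> B(1) by (simp add: mu_l_def field_simps)
    ultimately show
      "C1_quadratic_decay (5200 * B\<^sup>2 * mu_l \<theta> \<omega>0 lam nn l) (\<lambda>x. phi_hat_l \<theta> \<omega>0 lam nn l x - H x)"
      unfolding phi_hat_l_eq mu_l_def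
      by (intro C1_quadratic_decay_dyadic_prod_diff C1_u_l u_l_close l B)
  qed (use B in auto)
qed

theorem time_radius_sq_phi_orth_l_close:
  obtains \<epsilon> C where "0 < \<epsilon>" "0 \<le> C"
    "\<And>lam nn l. \<lbrakk>3 \<le> l; mu_l \<theta> \<omega>0 lam nn l \<le> \<epsilon>\<rbrakk> \<Longrightarrow>
      \<bar>time_radius_sq (phi_orth_l \<theta> \<omega>0 lam nn l) - time_radius_sq (meyer_phi \<theta> \<omega>0)\<bar>
        \<le> C * mu_l \<theta> \<omega>0 lam nn l"
proof -
  obtain K where K: "C1_quadratic_decay K H" by (rule H_decay)
  obtain \<delta> L where radius: "0 < \<delta>" "0 \<le> L"
    "\<And>f D. \<lbrakk>C1_quadratic_decay D (\<lambda>x. f x - H x); D \<le> \<delta>\<rbrakk> \<Longrightarrow>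
      \<bar>hat_radius_sq (orthogonalize f) - hat_radius_sq H\<bar> \<le> L * D"
    using hat_radius_sq_orthogonalize_lipschitz[OF K meyer_hat_orthogonal H_square_integral_pos]
    by blast
  obtain \<epsilon> C where phi: "0 < \<epsilon>" "0 \<le> C"
    "\<And>lam nn l. \<lbrakk>3 \<le> l; mu_l \<theta> \<omega>0 lam nn l \<le> \<epsilon>\<rbrakk> \<Longrightarrow>
      C1_quadratic_decay (C * mu_l \<theta> \<omega>0 lam nn l) (\<lambda>x. phi_hat_l \<theta> \<omega>0 lam nn l x - H x)"
    using phi_hat_l_close by blast
  show ?thesis
  proof (rule that[of "min \<epsilon> (\<delta> / (C + 1))" "L * C"])
    fix lam nn and l :: nat assume l: "3 \<le> l" and \<mu>: "mu_l \<theta> \<omega>0 lam nn l \<le> min \<epsilon> (\<delta> / (C + 1))"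
    have "0 \<le> mu_l \<theta> \<omega>0 lam nn l" using l by (intro alpha_l_le_mu_l) simp
    then have "C * mu_l \<theta> \<omega>0 lam nn l \<le> \<delta>"
      using \<mu> phi(2) by (simp add: pos_le_divide_eq algebra_simps)
    with radius(3)[OF phi(3)[OF l]] \<mu>
    show "\<bar>time_radius_sq (phi_orth_l \<theta> \<omega>0 lam nn l) - time_radius_sq (meyer_phi \<theta> \<omega>0)\<bar> \<le>
        L * C * mu_l \<theta> \<omega>0 lam nn l"
      by (simp add: phi_orth_l_eq meyer_phi_def mult.assoc)
  qed (use radius(1,2) phi(1,2) in simp_all)
qed

end

lemma mu_l_tendsto_0:
  assumes "alpha_l \<theta> \<omega>0 lam nn \<in> o[sequentially](\<lambda>l. 1 / real l)"
    "gamma_l \<theta> \<omega>0 lam nn \<in> o[sequentially](\<lambda>l. 1)"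
  shows "mu_l \<theta> \<omega>0 lam nn \<longlonglongrightarrow> 0"
  using tendsto_add[OF smalloD_tendsto[OF assms(1)] smalloD_tendsto[OF assms(2)]]
  by (simp add: mu_l_def[abs_def] mult.commute)

theorem theorem6:
  fixes \<theta> :: "real \<Rightarrow> real" and \<omega>0 :: real
    and lam :: "nat \<Rightarrow> nat \<Rightarrow> real" and nn :: "nat \<Rightarrow> nat" and l0 :: nat and c :: real
  assumes theta_odd: "\<And>x. \<theta> (- x) = - \<theta> x"
    and theta_mono: "mono \<theta>"
    and theta_C2: "C2_real \<theta>"
    and theta_const: "\<And>x. x > pi / 3 \<Longrightarrow> \<theta> x = pi / 4"
    and omega0: "pi / 3 \<le> \<omega>0" "\<omega>0 < pi / 2"
    and alpha_small: "alpha_l \<theta> \<omega>0 lam nn \<in> o[sequentially](\<lambda>l. 1 / real l)"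
    and gamma_small: "gamma_l \<theta> \<omega>0 lam nn \<in> o[sequentially](\<lambda>l. 1)"
    and u_pi: "\<And>l. u_l \<theta> \<omega>0 lam nn l pi \<noteq> 0"
    and c_def: "c = (INF l\<in>{l0..}. \<bar>u_l \<theta> \<omega>0 lam nn l 0\<bar>)"
    and c_pos: "c > 0"
  shows "(\<lambda>l. \<bar>time_radius_sq (phi_orth_l \<theta> \<omega>0 lam nn l) - time_radius_sq (meyer_phi \<theta> \<omega>0)\<bar>)
     \<in> O[sequentially](\<lambda>l. max (mu_l \<theta> \<omega>0 lam nn l)
          (real l * C0_const \<omega>0 powr (- real l + 2 * log 2 ((1 + eps_l \<theta> \<omega>0 lam nn l) / c))))"
proof -
  interpret meyer \<theta> \<omega>0 using theta_odd theta_C2 theta_const omega0 by unfold_locales auto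
  let ?mu = "mu_l \<theta> \<omega>0 lam nn"
  let ?bound = "\<lambda>l. max (?mu l)
    (real l * C0_const \<omega>0 powr (- real l + 2 * log 2 ((1 + eps_l \<theta> \<omega>0 lam nn l) / c)))"
  obtain \<epsilon> C where \<epsilon>: "0 < \<epsilon>" and C: "0 \<le> C"
    and close: "\<And>lam nn l. \<lbrakk>3 \<le> l; mu_l \<theta> \<omega>0 lam nn l \<le> \<epsilon>\<rbrakk> \<Longrightarrow>
      \<bar>time_radius_sq (phi_orth_l \<theta> \<omega>0 lam nn l) - time_radius_sq (meyer_phi \<theta> \<omega>0)\<bar>
        \<le> C * mu_l \<theta> \<omega>0 lam nn l"
    using time_radius_sq_phi_orth_l_close by blast
  have "\<forall>\<^sub>F l in sequentially. ?mu l < \<epsilon>"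
    by (rule order_tendstoD(2)[OF mu_l_tendsto_0[OF alpha_small gamma_small] \<epsilon>])
  then have "\<forall>\<^sub>F l in sequentially.
      norm \<bar>time_radius_sq (phi_orth_l \<theta> \<omega>0 lam nn l) - time_radius_sq (meyer_phi \<theta> \<omega>0)\<bar>
      \<le> C * norm (?bound l)"
    using eventually_ge_at_top[of 3]
  proof eventually_elim
    case (elim l)
    have "C * ?mu l \<le> C * norm (?bound l)" using C by (intro mult_left_mono) auto
    then show ?case using close[of l lam nn] elim by simp
  qed
  then show ?thesis by (rule bigoI)
qed

end
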